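(* Let $N\geq 2$, $f\in C^1(\mathbb{R})$, and let $u$ be a radial stable solution of $-\Delta u=f(u)$ in $\mathbb{R}^N\setminus B_1$ satisfying the following property: $(H_S)$ For every $R_1\geq 1$ there exist $R_2>R_1$ and $\eta_0\in C^{0,1}([R_1,R_2])$ such that $\eta_0(R_2)=0$ and $$\int_{R_1}^{R_2} r^{N-1}u_r^2\left(\eta_0'^2-\frac{N-1}{r^2}\eta_0^2\right)dr<0.$$ Then the limit $u_\infty:=\lim_{r\to\infty}u(r)\in[-\infty,+\infty]$ exists and there exists $M>0$ such that - $|u(r)|\leq M\log(r)$ for all $r\geq 2$, if $N=2$; - $|u(r)-u_\infty|\leq M r^{-N/2-\sqrt{N-1}+2}$ for all $r\geq 1$, if $N\geq 3$ (in particular $u_\infty\in\mathbb{R}$ in this case).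
   Context: $B_1$ is the open unit ball of $\mathbb{R}^N$, so $\mathbb{R}^N\setminus B_1=\{x:|x|\geq 1\}$. Solutions are classical: $u\in C^2(\mathbb{R}^N\setminus B_1)$ (up to the boundary). A solution $u$ of $-\Delta u=f(u)$ in $\mathbb{R}^N\setminus B_1$ is called stable if $\int_{\mathbb{R}^N\setminus\overline{B_1}}\left(|\nabla v|^2-f'(u)v^2\right)dx\geq 0$ for every $v\in C^1(\mathbb{R}^N\setminus\overline{B_1})$ with compact support in $\mathbb{R}^N\setminus\overline{B_1}$. For radial $u$ one writes $u(r)$ for $u(x)$ with $r=|x|$, and $u_r$ is the radial derivative. $C^{0,1}$ denotes Lipschitz functions. *)

theory Defs
  imports "HOL-Analysis.Analysis"
begin

definition ext_closed :: "'a::euclidean_space set" where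
  "ext_closed = {x. norm x \<ge> 1}"

definition ext_open :: "'a::euclidean_space set" where
  "ext_open = {x. norm x > 1}"

text \<open>
  Derivatives are taken within \<open>S\<close>. On open sets these are the ordinary ones; on
  \<open>ext_closed\<close> they are still uniquely determined, one-sided at the boundary sphere,
  so that \<open>C2_on ext_closed\<close> is regularity up to the boundary.
\<close>

definition C1_on :: "'a::euclidean_space set \<Rightarrow> ('a \<Rightarrow> 'b::real_normed_vector) \<Rightarrow> bool" where
  "C1_on S v \<longleftrightarrow>
    (\<exists>v' :: 'a \<Rightarrow> 'a \<Rightarrow>\<^sub>L 'b. continuous_on S v' \<and>
      (\<forall>x\<in>S. (v has_derivative blinfun_apply (v' x)) (at x within S)))"

definition C2_on :: "'a::euclidean_space set \<Rightarrow> ('a \<Rightarrow> 'b::real_normed_vector) \<Rightarrow> bool" where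
  "C2_on S v \<longleftrightarrow>
    (\<exists>v' :: 'a \<Rightarrow> 'a \<Rightarrow>\<^sub>L 'b. C1_on S v' \<and>
      (\<forall>x\<in>S. (v has_derivative blinfun_apply (v' x)) (at x within S)))"

definition grad_on :: "'a::euclidean_space set \<Rightarrow> ('a \<Rightarrow> real) \<Rightarrow> 'a \<Rightarrow> 'a" where
  "grad_on S v x = (\<Sum>b\<in>Basis. frechet_derivative v (at x within S) b *\<^sub>R b)"

definition laplacian_on :: "'a::euclidean_space set \<Rightarrow> ('a \<Rightarrow> real) \<Rightarrow> 'a \<Rightarrow> real" where
  "laplacian_on S v x =
    (\<Sum>b\<in>Basis. frechet_derivative (grad_on S v) (at x within S) b \<bullet> b)"

definition classical_solution :: "(real \<Rightarrow> real) \<Rightarrow> ('a::euclidean_space \<Rightarrow> real) \<Rightarrow> bool" where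
  "classical_solution f u \<longleftrightarrow>
    C2_on ext_closed u \<and> (\<forall>x\<in>ext_closed. - laplacian_on ext_closed u x = f (u x))"

definition test_function :: "('a::euclidean_space \<Rightarrow> real) \<Rightarrow> bool" where
  "test_function v \<longleftrightarrow>
    C1_on ext_open v \<and> compact (closure (support_on ext_open v)) \<and>
    closure (support_on ext_open v) \<subseteq> ext_open"

definition stable_solution :: "(real \<Rightarrow> real) \<Rightarrow> ('a::euclidean_space \<Rightarrow> real) \<Rightarrow> bool" where
  "stable_solution f u \<longleftrightarrow>
    (\<forall>v. test_function v \<longrightarrow>
      (LINT x:ext_open|lebesgue. (norm (grad_on ext_open v x))\<^sup>2 - deriv f (u x) * (v x)\<^sup>2) \<ge> 0)"

text \<open>\<open>u\<close> is radial, and \<open>U r\<close> for \<open>r \<ge> 1\<close> is its value on the sphere of radius \<open>r\<close>.\<close>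

definition radial_profile :: "('a::euclidean_space \<Rightarrow> real) \<Rightarrow> (real \<Rightarrow> real) \<Rightarrow> bool" where
  "radial_profile u U \<longleftrightarrow> (\<forall>x\<in>ext_closed. u x = U (norm x))"

definition radial_deriv :: "(real \<Rightarrow> real) \<Rightarrow> real \<Rightarrow> real" where
  "radial_deriv U r = vector_derivative U (at r within {1..})"

text \<open>
  A Lipschitz \<open>\<eta>\<close> is differentiable almost everywhere; at the exceptional null set
  \<open>deriv \<eta>\<close> is unspecified. The integral is therefore taken over the completed measure
  \<open>lebesgue\<close>, for which null sets matter neither for measurability nor for the value.
\<close>

definition HS :: "nat \<Rightarrow> (real \<Rightarrow> real) \<Rightarrow> bool" where
  "HS N U \<longleftrightarrow>
    (\<forall>R1\<ge>1. \<exists>R2>R1. \<exists>\<eta>. (\<exists>L. L-lipschitz_on {R1..R2} \<eta>) \<and> \<eta> R2 = 0 \<and>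
      (LINT r:{R1..R2}|lebesgue.
         r ^ (N - 1) * (radial_deriv U r)\<^sup>2 *
           ((deriv \<eta> r)\<^sup>2 - (real N - 1) / r\<^sup>2 * (\<eta> r)\<^sup>2)) < 0)"

end

theory Submission
  imports Defs
begin

text \<open>
  Testing stability with \<open>v = u\<^sub>r \<eta>\<close>, where \<open>\<eta>\<close> is radial, and using the equation
  differentiated in \<open>r\<close> gives the weighted Hardy-type inequality
  \<open>\<integral> r\<^bsup>N-1\<^esup> u\<^sub>r\<^sup>2 (\<eta>'\<^sup>2 - (N-1)/r\<^sup>2 \<eta>\<^sup>2) dr \<ge> 0\<close>, which extends from \<open>C\<^sup>1\<close> to Lipschitz \<open>\<eta>\<close>.
  The hypothesis \<open>HS\<close> allows any \<open>\<eta>\<close> on \<open>[1, R]\<close>, vanishing near \<open>1\<close>, to be continued to the right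
  of \<open>R\<close> by a multiple of \<open>\<eta>\<^sub>0\<close> of negative energy, so \<open>\<eta>\<close> need not vanish at \<open>R\<close>.
  With \<open>s = sqrt (N - 1)\<close> the power \<open>r\<^sup>s\<close> has zero energy density; truncating it at \<open>r\<^sub>0\<close> to a
  constant yields \<open>\<integral>\<^bsub>r\<^sub>0\<^esub>\<^bsup>\<infinity>\<^esup> r\<^bsup>N-3\<^esup> u\<^sub>r\<^sup>2 dr \<le> C r\<^sub>0\<^bsup>-2s\<^esup>\<close>. A weighted AM-GM inequality
  on \<open>[r, 2r]\<close> and dyadic summation give the decay rates. Starting the truncated power with a steep ramp at a zero
  of \<open>u\<^sub>r\<close> makes the right-hand side arbitrarily small, so \<open>u\<^sub>r\<close> is eventually zero
  or never changes sign, and \<open>u\<close> has a limit.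
\<close>

section \<open>Lipschitz functions of one variable are almost everywhere differentiable\<close>

text \<open>An interval is the closed ball around its midpoint, so the Vitali theorem for balls
  applies, with pairs of endpoints as indices. The point \<open>x\<close> may be an endpoint of its
  interval, because the intervals used later are spanned by \<open>x\<close> and a nearby
  \<open>y\<close>.\<close>

lemma Vitali_covering_intervals:
  fixes S G :: "real set" and P :: "real \<Rightarrow> real \<Rightarrow> bool"
  assumes G: "open G" "S \<subseteq> G"
    and fine: "\<And>x \<delta>. x \<in> S \<Longrightarrow> \<delta> > 0 \<Longrightarrow> \<exists>c d. c < d \<and> d - c < \<delta> \<and> c \<le> x \<and> x \<le> d \<and> P c d"
  obtains C :: "(real \<times> real) set" where "countable C"
    "\<forall>i\<in>C. fst i < snd i \<and> P (fst i) (snd i) \<and> {fst i..snd i} \<subseteq> G"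
    "disjoint_family_on (\<lambda>i. {fst i..snd i}) C"
    "negligible (S - (\<Union>i\<in>C. {fst i..snd i}))"
proof -
  define K where "K = {i :: real \<times> real. fst i < snd i \<and> P (fst i) (snd i) \<and> {fst i..snd i} \<subseteq> G}"
  let ?r = "\<lambda>i :: real \<times> real. (snd i - fst i) / 2" and ?a = "\<lambda>i :: real \<times> real. (fst i + snd i) / 2"
  have cball: "cball (?a i) (?r i) = {fst i..snd i}" for i
    by (auto simp: cball_eq_atLeastAtMost field_simps)
  have pos: "0 < ?r i" if "i \<in> K" for i
    using that by (auto simp: K_def)
  have cov: "\<exists>i. i \<in> K \<and> x \<in> cball (?a i) (?r i) \<and> ?r i < d" if x: "x \<in> S" and d: "0 < d" for x d
  proof -
    obtain e where e: "e > 0" "ball x e \<subseteq> G"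
      using G x by (meson openE subsetD)
    obtain c1 d1 where cd: "c1 < d1" "d1 - c1 < min d e" "c1 \<le> x" "x \<le> d1" "P c1 d1"
      using fine[OF x, of "min d e"] d e by auto
    have "{c1..d1} \<subseteq> ball x e"
      using cd by (auto simp: dist_real_def)
    with e cd have "(c1, d1) \<in> K"
      by (auto simp: K_def)
    moreover have "x \<in> cball (?a (c1, d1)) (?r (c1, d1))"
      unfolding cball using cd by auto
    ultimately show ?thesis
      using cd d by (intro exI[of _ "(c1, d1)"]) auto
  qed
  obtain C where C: "countable C" "C \<subseteq> K"
      "pairwise (\<lambda>i j. disjnt (cball (?a i) (?r i)) (cball (?a j) (?r j))) C"
      "negligible (S - (\<Union>i \<in> C. cball (?a i) (?r i)))"
    by (rule Vitali_covering_theorem_cballs[of K ?r S ?a]) (use pos cov in auto)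
  show ?thesis
  proof (rule that[of C])
    show "disjoint_family_on (\<lambda>i. {fst i..snd i}) C"
      using C(3) unfolding cball disjoint_family_on_def pairwise_def disjnt_def by auto
  qed (use C in \<open>auto simp: cball K_def\<close>)
qed

text \<open>Countable additivity sums the comparison over the disjoint intervals. With a factor on
  each side, one statement serves slopes bounded from above as well as slopes bounded from
  below.\<close>

lemma emeasure_intervals_le:
  fixes C :: "(real \<times> real) set" and M N :: "real measure"
  assumes "countable C" "disjoint_family_on (\<lambda>i. {fst i..snd i}) C"
    and [measurable_cong]: "sets M = sets borel" "sets N = sets borel"
    and le: "\<And>i. i \<in> C \<Longrightarrow> k * emeasure M {fst i..snd i} \<le> l * emeasure N {fst i..snd i}"
  shows "k * emeasure M (\<Union>i\<in>C. {fst i..snd i}) \<le> l * emeasure N (\<Union>i\<in>C. {fst i..snd i})"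
proof -
  have eq: "emeasure M' (\<Union>i\<in>C. {fst i..snd i}) = (\<integral>\<^sup>+i. emeasure M' {fst i..snd i} \<partial>count_space C)"
    if "sets M' = sets borel" for M' :: "real measure"
    by (rule emeasure_UN_countable) (use assms that in auto)
  show ?thesis
    unfolding eq[OF assms(3)] eq[OF assms(4)]
    by (subst (1 2) nn_integral_cmult[symmetric]) (auto intro!: nn_integral_mono le)
qed

lemma negligible_oscillating_slopes:
  fixes F :: "real \<Rightarrow> real"
  assumes mono: "mono F" and cont: "continuous_on UNIV F" and pq: "0 \<le> p" "p < q"
  shows "negligible {x. (\<forall>\<delta>>0. \<exists>y. y \<noteq> x \<and> \<bar>y - x\<bar> < \<delta> \<and> (F y - F x) / (y - x) < p) \<and>
                        (\<forall>\<delta>>0. \<exists>y. y \<noteq> x \<and> \<bar>y - x\<bar> < \<delta> \<and> (F y - F x) / (y - x) > q)}"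
    (is "negligible ?E")
proof -
  \<comment> \<open>Vitali coverings are taken twice: by intervals of slope at most \<open>p\<close>, then inside these by
    intervals of slope at least \<open>q\<close>. Comparing \<open>\<mu>\<close> with Lebesgue measure on both bounds the
    outer measure \<open>m\<close> by \<open>q m \<le> p m\<close>.\<close>
  define \<mu> where "\<mu> = interval_measure F"
  have F_mono: "F x \<le> F y" if "x \<le> y" for x y
    using mono that by (auto simp: mono_def)
  have sets_\<mu> [measurable_cong]: "sets \<mu> = sets borel"
    by (simp add: \<mu>_def)
  have \<mu>: "emeasure \<mu> {c..d} = ennreal (F d - F c)" if "c \<le> d" for c d
    unfolding \<mu>_def by (rule emeasure_interval_measure_Icc) (use that F_mono cont in \<open>auto intro: continuous_on_subset\<close>)
  have low: "\<exists>c d. c < d \<and> d - c < \<delta> \<and> c \<le> x \<and> x \<le> d \<and> F d - F c \<le> p * (d - c)"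
    if "x \<in> ?E" "\<delta> > 0" for x \<delta>
  proof -
    obtain y where y: "y \<noteq> x" "\<bar>y - x\<bar> < \<delta>" "(F y - F x) / (y - x) < p"
      using \<open>x \<in> ?E\<close> \<open>\<delta> > 0\<close> by blast
    have "F (max x y) - F (min x y) \<le> p * (max x y - min x y)"
      using y by (auto simp: max_def min_def field_simps split: if_splits)
    then show ?thesis
      using y by (intro exI[of _ "min x y"] exI[of _ "max x y"]) auto
  qed
  have high: "\<exists>c d. c < d \<and> d - c < \<delta> \<and> c \<le> x \<and> x \<le> d \<and> F d - F c \<ge> q * (d - c)"
    if "x \<in> ?E" "\<delta> > 0" for x \<delta>
  proof -
    obtain y where y: "y \<noteq> x" "\<bar>y - x\<bar> < \<delta>" "(F y - F x) / (y - x) > q"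
      using \<open>x \<in> ?E\<close> \<open>\<delta> > 0\<close> by blast
    have "F (max x y) - F (min x y) \<ge> q * (max x y - min x y)"
      using y by (auto simp: max_def min_def field_simps split: if_splits)
    then show ?thesis
      using y by (intro exI[of _ "min x y"] exI[of _ "max x y"]) auto
  qed
  \<comment> \<open>The bounded window makes the outer measure \<open>m\<close> finite, without
    which \<open>q m \<le> p m\<close> would not force \<open>m = 0\<close>.\<close>
  have "negligible (?E \<inter> {-real n<..<real n})" for n
  proof -
    define E where "E = ?E \<inter> {-real n<..<real n}"
    \<comment> \<open>Measurability of \<open>E\<close> is not known, so a measurable hull
      \<open>H\<close> of the same outer measure is used.\<close>
    obtain H where H: "H \<in> sets lebesgue" "E \<subseteq> H" "outer_measure_of lebesgue E = emeasure lebesgue H"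
      using outer_measure_of_attain[of E lebesgue] by auto
    define m where "m = outer_measure_of lebesgue E"
    have "m \<le> outer_measure_of lebesgue {-real n<..<real n}"
      unfolding m_def by (rule outer_measure_of_mono) (auto simp: E_def)
    also have "\<dots> < \<infinity>"
      by (subst outer_measure_of_eq) auto
    finally have m_fin: "m < \<infinity>" .
    have *: "ennreal q * m \<le> ennreal p * (m + ennreal e)" if "e > 0" for e :: real
    proof -
      obtain G where G: "open G" "H \<subseteq> G" "emeasure lebesgue (G - H) < ennreal e"
        using sets_lebesgue_outer_open[OF H(1) \<open>e > 0\<close>] by metis
      have "emeasure lebesgue H + emeasure lebesgue (G - H) = emeasure lebesgue (H \<union> (G - H))"
        using G H by (intro plus_emeasure) auto
      also have "H \<union> (G - H) = G"
        using G by auto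
      finally have "emeasure lebesgue H + emeasure lebesgue (G - H) = emeasure lborel G"
        using G by simp
      then have G_le: "emeasure lborel G \<le> m + ennreal e"
        using G H unfolding m_def by (metis add_left_mono less_imp_le)
      obtain B where B: "countable B"
          "\<forall>i\<in>B. fst i < snd i \<and> F (snd i) - F (fst i) \<le> p * (snd i - fst i) \<and> {fst i..snd i} \<subseteq> G"
          "disjoint_family_on (\<lambda>i. {fst i..snd i}) B"
          "negligible (E - (\<Union>i\<in>B. {fst i..snd i}))"
        by (rule Vitali_covering_intervals[of G E "\<lambda>c d. F d - F c \<le> p * (d - c)"])
           (use G H low in \<open>auto simp: E_def\<close>)
      \<comment> \<open>Open intervals are taken so that the second covering can be fitted inside
        the first. The endpoints lost in this way are countable and go into the null set
        \<open>Z\<close>.\<close>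
      define G' where "G' = (\<Union>i\<in>B. {fst i<..<snd i})"
      have "open G'"
        unfolding G'_def by (intro open_UN ballI open_greaterThanLessThan)
      have highE: "\<exists>c d. c < d \<and> d - c < \<delta> \<and> c \<le> x \<and> x \<le> d \<and> F d - F c \<ge> q * (d - c)"
        if "x \<in> E \<inter> G'" "\<delta> > 0" for x \<delta>
        by (rule high) (use that in \<open>simp_all only: E_def Int_iff\<close>)
      obtain C where C: "countable C"
          "\<forall>i\<in>C. fst i < snd i \<and> F (snd i) - F (fst i) \<ge> q * (snd i - fst i) \<and> {fst i..snd i} \<subseteq> G'"
          "disjoint_family_on (\<lambda>i. {fst i..snd i}) C"
          "negligible ((E \<inter> G') - (\<Union>i\<in>C. {fst i..snd i}))"
        by (rule Vitali_covering_intervals[of G' "E \<inter> G'" "\<lambda>c d. F d - F c \<ge> q * (d - c)",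
              OF \<open>open G'\<close> Int_lower2 highE]) (assumption | rule that)+
      let ?B = "\<Union>i\<in>B. {fst i..snd i}" and ?C = "\<Union>i\<in>C. {fst i..snd i}"
      have sets: "?B \<in> sets borel" "?C \<in> sets borel"
        using B(1) C(1) by (auto intro!: sets.countable_UN')
      define Z where "Z = (E - ?B) \<union> ((E \<inter> G') - ?C) \<union> (fst ` B \<union> snd ` B)"
      have "negligible Z"
      proof -
        have "negligible (fst ` B \<union> snd ` B)"
          using B(1) by (simp add: negligible_iff_null_sets countable_imp_null_set_lborel null_sets_completionI)
        then show ?thesis
          unfolding Z_def using B(4) C(4) by (intro negligible_Un) auto
      qed
      have "E \<subseteq> ?C \<union> Z"
      proof
        fix x assume "x \<in> E"
        show "x \<in> ?C \<union> Z"
        proof (rule ccontr)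
          assume x: "x \<notin> ?C \<union> Z"
          with \<open>x \<in> E\<close> obtain i where i: "i \<in> B" "fst i \<le> x" "x \<le> snd i"
            by (auto simp: Z_def)
          moreover have "x \<noteq> fst i" "x \<noteq> snd i"
            using x i by (auto simp: Z_def)
          ultimately have "x \<in> G'"
            unfolding G'_def by (intro UN_I[of i]) auto
          with x \<open>x \<in> E\<close> show False
            by (auto simp: Z_def)
        qed
      qed
      then have "m \<le> outer_measure_of lebesgue (?C \<union> Z)"
        unfolding m_def by (rule outer_measure_of_mono)
      also have "\<dots> = emeasure lebesgue (?C \<union> Z)"
        using sets \<open>negligible Z\<close> by (intro outer_measure_of_eq) (auto simp: negligible_iff_null_sets)
      also have "\<dots> = emeasure lebesgue ?C"
        using sets \<open>negligible Z\<close> by (intro emeasure_Un_null_set) (auto simp: negligible_iff_null_sets)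
      also have "\<dots> = emeasure lborel ?C"
        using sets by simp
      finally have "ennreal q * m \<le> ennreal q * emeasure lborel ?C"
        by (rule mult_left_mono) simp
      also have "\<dots> \<le> 1 * emeasure \<mu> ?C"
      proof (rule emeasure_intervals_le[OF C(1,3)])
        fix i assume "i \<in> C"
        with C(2) show "ennreal q * emeasure lborel {fst i..snd i} \<le> 1 * emeasure \<mu> {fst i..snd i}"
          using pq by (auto simp: \<mu> less_imp_le ennreal_mult[symmetric] intro!: ennreal_leI)
      qed (simp_all add: sets_\<mu>)
      also have "\<dots> \<le> 1 * emeasure \<mu> ?B"
      proof -
        have "G' \<subseteq> ?B"
          unfolding G'_def by (intro UN_mono) auto
        moreover have "?C \<subseteq> G'"
          by (intro UN_least) (use C(2) in simp)
        ultimately have "?C \<subseteq> ?B"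
          by (rule order_trans[rotated])
        then show ?thesis
          using sets by (auto intro!: emeasure_mono)
      qed
      also have "\<dots> \<le> ennreal p * emeasure lborel ?B"
      proof (rule emeasure_intervals_le[OF B(1,3)])
        fix i assume "i \<in> B"
        with B(2) show "1 * emeasure \<mu> {fst i..snd i} \<le> ennreal p * emeasure lborel {fst i..snd i}"
          using pq by (auto simp: \<mu> less_imp_le ennreal_mult[symmetric] intro!: ennreal_leI)
      qed (simp_all add: sets_\<mu>)
      also have "\<dots> \<le> ennreal p * emeasure lborel G"
        using B(2) G by (intro mult_left_mono emeasure_mono) auto
      also have "\<dots> \<le> ennreal p * (m + ennreal e)"
        by (intro mult_left_mono G_le) auto
      finally show ?thesis .
    qed
    obtain m' where m': "m = ennreal m'" "m' \<ge> 0"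
      using m_fin by (metis ennreal_cases infinity_ennreal_def less_irrefl)
    have "q * m' \<le> p * m' + e" if "e > 0" for e
    proof -
      \<comment> \<open>Dividing by \<open>p + 1\<close> rather than \<open>p\<close> includes the
        case \<open>p = 0\<close>; the resulting error \<open>p * (e / (p + 1))\<close> is at most
        \<open>e\<close>.\<close>
      have e': "e / (p + 1) > 0"
        using that pq by simp
      have "q * m' \<le> p * (m' + e / (p + 1))"
        using *[OF e'] pq m' e' by (simp add: ennreal_mult[symmetric] ennreal_plus[symmetric] del: ennreal_plus)
      also have "\<dots> \<le> p * m' + e"
        using pq that by (simp add: field_simps)
      finally show ?thesis .
    qed
    then have "q * m' \<le> p * m'"
      by (rule field_le_epsilon)
    with pq m' have "m' = 0"
      by (auto simp: mult_le_cancel_right)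
    then have "H \<in> null_sets lebesgue"
      using H m' by (auto simp: m_def null_sets_def)
    then show ?thesis
      using H(2) negligible_subset unfolding E_def negligible_iff_null_sets[symmetric] by blast
  qed
  then have "negligible (\<Union>n. ?E \<inter> {-real n<..<real n})"
    by (intro negligible_countable_Union) auto
  also have "(\<Union>n. ?E \<inter> {-real n<..<real n}) = ?E \<inter> (\<Union>n. {-real n<..<real n})"
    by (rule Int_UN_distrib[symmetric])
  also have "(\<Union>n. {-real n<..<real n}) = UNIV"
  proof (intro equalityI subsetI)
    fix x :: real
    obtain n where "\<bar>x\<bar> < real n"
      using reals_Archimedean2 by blast
    then show "x \<in> (\<Union>n. {-real n<..<real n})"
      by (intro UN_I[of n]) auto
  qed simp
  also have "?E \<inter> UNIV = ?E"
    by (rule Int_UNIV_right)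
  finally show ?thesis .
qed

text \<open>Monotonicity and the Lipschitz bound confine all difference quotients to
  \<open>[0, L]\<close>. If their lower and upper limits at \<open>x\<close> differed, rationals
  \<open>0 \<le> p < q\<close> between them would put \<open>x\<close> into the null set
  \<open>E p q\<close>, and there are only countably many such sets.\<close>

lemma mono_lipschitz_AE_differentiable:
  fixes F :: "real \<Rightarrow> real"
  assumes "mono F" and lip: "L-lipschitz_on UNIV F"
  shows "AE x in lebesgue. F differentiable (at x)"
proof -
  define E where "E p q = {x. (\<forall>\<delta>>0. \<exists>y. y \<noteq> x \<and> \<bar>y - x\<bar> < \<delta> \<and> (F y - F x) / (y - x) < p) \<and>
                        (\<forall>\<delta>>0. \<exists>y. y \<noteq> x \<and> \<bar>y - x\<bar> < \<delta> \<and> (F y - F x) / (y - x) > q)}" for p q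
  let ?I = "{i \<in> \<rat> \<times> \<rat>. 0 \<le> fst i \<and> fst i < snd i} :: (real \<times> real) set"
  have slope_ge: "0 \<le> (F y - F x) / (y - x)" for x y
    using \<open>mono F\<close> by (auto simp: mono_def divide_le_0_iff zero_le_divide_iff) (meson linear)
  have slope_le: "(F y - F x) / (y - x) \<le> L" if "y \<noteq> x" for x y
  proof -
    have "\<bar>F y - F x\<bar> \<le> L * \<bar>y - x\<bar>"
      using lipschitz_onD[OF lip, of y x] by (simp add: dist_real_def)
    then have "\<bar>(F y - F x) / (y - x)\<bar> \<le> L"
      using that by (simp add: abs_divide pos_divide_le_eq)
    then show ?thesis by linarith
  qed
  have "negligible (\<Union>i\<in>?I. E (fst i) (snd i))"
  proof (rule negligible_countable_Union)
    have "countable ?I"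
      by (rule countable_subset[of _ "\<rat> \<times> \<rat>"]) (auto intro: countable_rat)
    then show "countable ((\<lambda>i. E (fst i) (snd i)) ` ?I)"
      by blast
  next
    fix T assume "T \<in> (\<lambda>i. E (fst i) (snd i)) ` ?I"
    then show "negligible T"
      unfolding E_def using negligible_oscillating_slopes[OF \<open>mono F\<close> lipschitz_on_continuous_on[OF lip]] by auto
  qed
  moreover have "F differentiable (at x)" if x: "x \<notin> (\<Union>i\<in>?I. E (fst i) (snd i))" for x
  proof -
    let ?s = "\<lambda>y. (F y - F x) / (y - x)"
    let ?f = "\<lambda>y. ereal (?s y)"
    have bd: "0 \<le> Liminf (at x) ?f" "Limsup (at x) ?f \<le> ereal L"
      using slope_ge slope_le by (auto intro!: Liminf_bounded Limsup_bounded simp: eventually_at_filter zero_ereal_def)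
    have "Limsup (at x) ?f \<le> Liminf (at x) ?f"
    proof (rule ccontr)
      assume "\<not> ?thesis"
      then have "Liminf (at x) ?f < Limsup (at x) ?f" by simp
      then obtain q' where q': "Liminf (at x) ?f < ereal (real_of_rat q')" "ereal (real_of_rat q') < Limsup (at x) ?f"
        using ereal_dense3 by blast
      then obtain p' where p': "Liminf (at x) ?f < ereal (real_of_rat p')" "ereal (real_of_rat p') < ereal (real_of_rat q')"
        using ereal_dense3 by blast
      define p q where "p = real_of_rat p'" and "q = real_of_rat q'"
      have "0 \<le> p"
        using p' bd(1) unfolding p_def by (metis ereal_less_eq(3) less_imp_le order_trans zero_ereal_def)
      have "(p, q) \<in> ?I"
        using p' q' \<open>0 \<le> p\<close> by (auto simp: p_def q_def)
      have "\<exists>\<^sub>F y in at x. ?s y < p"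
      proof (rule ccontr)
        assume "\<not> ?thesis"
        then have "ereal p \<le> Liminf (at x) ?f"
          by (intro Liminf_bounded) (auto simp: not_frequently elim!: eventually_mono)
        then show False using p' by (simp add: p_def)
      qed
      moreover have "\<exists>\<^sub>F y in at x. ?s y > q"
      proof (rule ccontr)
        assume "\<not> ?thesis"
        then have "Limsup (at x) ?f \<le> ereal q"
          by (intro Limsup_bounded) (auto simp: not_frequently elim!: eventually_mono)
        then show False using q' by (simp add: q_def)
      qed
      ultimately have "x \<in> E p q"
        unfolding E_def frequently_def eventually_at dist_real_def by blast
      with \<open>(p, q) \<in> ?I\<close> x show False by force
    qed
    then have eq: "Liminf (at x) ?f = Limsup (at x) ?f"
      by (intro antisym Liminf_le_Limsup) auto
    obtain l where l: "Liminf (at x) ?f = ereal l"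
    proof -
      have "Liminf (at x) ?f \<noteq> \<infinity>" "Liminf (at x) ?f \<noteq> -\<infinity>"
        using bd eq by auto
      then show ?thesis
        using that by (cases "Liminf (at x) ?f") auto
    qed
    have "(?f \<longlongrightarrow> ereal l) (at x)"
      by (rule Liminf_eq_Limsup) (use l eq in auto)
    then have "(F has_real_derivative l) (at x)"
      by (simp add: has_field_derivative_iff)
    then show ?thesis
      using real_differentiable_def by blast
  qed
  ultimately show ?thesis
    by (intro AE_I'[of "\<Union>i\<in>?I. E (fst i) (snd i)"]) (simp_all only: negligible_iff_null_sets, blast)
qed

text \<open>Adding \<open>L * x\<close> makes the function monotone and keeps it Lipschitz;
  subtracting it again preserves differentiability.\<close>

lemma lipschitz_AE_differentiable:
  fixes f :: "real \<Rightarrow> real"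
  assumes lip: "L-lipschitz_on UNIV f"
  shows "AE x in lebesgue. f differentiable (at x)"
proof -
  let ?F = "\<lambda>x. f x + L * x"
  have "mono ?F"
  proof (rule monoI)
    fix x y :: real assume "x \<le> y"
    then show "?F x \<le> ?F y"
      using lipschitz_onD[OF lip, of x y] by (auto simp: dist_real_def algebra_simps)
  qed
  moreover have "(L + \<bar>L\<bar> * 1)-lipschitz_on UNIV ?F"
    by (intro lipschitz_intros lip lipschitz_on_cmult_real)
  ultimately have "AE x in lebesgue. ?F differentiable (at x)"
    by (rule mono_lipschitz_AE_differentiable)
  then show ?thesis
  proof eventually_elim
    case (elim x)
    then obtain D where "(?F has_real_derivative D) (at x)"
      by (auto simp: real_differentiable_def)
    then have "((\<lambda>y. ?F y - L * y) has_real_derivative D - L) (at x)"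
      by (intro DERIV_diff) (auto intro!: derivative_eq_intros)
    then show ?case
      by (auto simp: real_differentiable_def)
  qed
qed

section \<open>Stability against Lipschitz perturbations\<close>

lemma set_integrable_lebesgue_continuous:
  fixes f :: "real \<Rightarrow> real"
  assumes "continuous_on {a..b} f"
  shows "set_integrable lebesgue {a..b} f"
  using absolutely_integrable_continuous_real[OF assms] .

text \<open>In the application \<open>w\<close> is r^(N-1) u_r^2 and \<open>V\<close> is (N-1)/r^2.
  The assumption \<open>stable_C1\<close> covers only C^1 functions supported in a compact part of
  (1, infinity), which is what radial test functions provide directly.\<close>

locale weighted_stable =
  fixes w V :: "real \<Rightarrow> real"
  assumes w_cont: "continuous_on {1<..} w" and w_nonneg: "\<And>r. r > 1 \<Longrightarrow> 0 \<le> w r"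
    and V_cont: "continuous_on {1<..} V"
    and stable_C1: "\<And>a b \<eta> \<eta>'. 1 < a \<Longrightarrow> a < b \<Longrightarrow> (\<And>r. (\<eta> has_real_derivative \<eta>' r) (at r)) \<Longrightarrow>
      continuous_on UNIV \<eta>' \<Longrightarrow> (\<And>r. r \<notin> {a..b} \<Longrightarrow> \<eta> r = 0) \<Longrightarrow>
      0 \<le> (LINT r:{a..b}|lebesgue. w r * ((\<eta>' r)\<^sup>2 - V r * (\<eta> r)\<^sup>2))"
begin

lemma bounded_on_Icc:
  fixes a b :: real
  assumes "1 < a" "continuous_on {1<..} g"
  obtains K where "\<And>r. r \<in> {a..b} \<Longrightarrow> \<bar>g r :: real\<bar> \<le> K" "0 \<le> K"
proof -
  have "compact (g ` {a..b})"
    using assms by (intro compact_continuous_image continuous_on_subset[OF assms(2)]) auto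
  then obtain K where "\<forall>y\<in>g ` {a..b}. norm y \<le> K"
    using compact_imp_bounded bounded_iff by metis
  then show ?thesis
    by (intro that[of "max K 0"]) (force simp: le_max_iff_disj)+
qed

text \<open>Dominated convergence carries the inequality from C^1 approximations to
  \<open>\<eta>\<close>. The smoothing averages to the right over a length of at most
  \<open>a - c\<close>, so it can enlarge the support only on the left, from \<open>a\<close> down
  to \<open>c\<close>.\<close>

lemma stable_lipschitz:
  assumes ab: "1 < a" "a < b" and lip: "L-lipschitz_on UNIV \<eta>"
    and supp: "\<And>r. r \<notin> {a..b} \<Longrightarrow> \<eta> r = 0" and c: "1 < c" "c < a"
  shows "set_integrable lebesgue {c..b} (\<lambda>r. w r * ((deriv \<eta> r)\<^sup>2 - V r * (\<eta> r)\<^sup>2))"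
    and "0 \<le> (LINT r:{c..b}|lebesgue. w r * ((deriv \<eta> r)\<^sup>2 - V r * (\<eta> r)\<^sup>2))"
proof -
  have L: "\<bar>\<eta> x - \<eta> y\<bar> \<le> L * \<bar>x - y\<bar>" for x y
    using lipschitz_onD[OF lip, of x y] by (simp add: dist_real_def)
  have "0 \<le> L" using lip by (rule lipschitz_on_nonneg)
  have cont: "continuous_on UNIV \<eta>"
    by (rule lipschitz_on_continuous_on[OF lip])
  define B where "B = L * (b + 1 - a)"
  have B: "\<bar>\<eta> x\<bar> \<le> B" for x
  proof (cases "x \<in> {a..b}")
    case True
    have "\<bar>\<eta> x\<bar> = \<bar>\<eta> x - \<eta> (b + 1)\<bar>"
      using supp[of "b + 1"] by simp
    also have "\<dots> \<le> L * \<bar>x - (b + 1)\<bar>" by (rule L)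
    also have "\<dots> \<le> B"
      unfolding B_def using True \<open>0 \<le> L\<close> by (intro mult_left_mono) auto
    finally show ?thesis .
  qed (use supp ab \<open>0 \<le> L\<close> in \<open>auto simp: B_def\<close>)
  have "\<exists>G. \<forall>x::real. -\<infinity> < ereal x \<longrightarrow> ereal x < \<infinity> \<longrightarrow> (G has_vector_derivative \<eta> x) (at x)"
    using cont by (intro einterval_antiderivative) (auto simp: continuous_on_eq_continuous_at)
  then obtain G where G: "\<And>x. (G has_real_derivative \<eta> x) (at x)"
    by (auto simp: has_real_derivative_iff_has_vector_derivative)
  \<comment> \<open>\<open>\<phi> n\<close> is the Steklov average of \<open>\<eta>\<close> over \<open>[r, r + h n]\<close>, a \<open>C\<^sup>1\<close> approximation whose
    derivatives are bounded by \<open>L\<close> and converge wherever \<open>\<eta>\<close> is differentiable.\<close>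
  define h where "h n = (a - c) * inverse (real (Suc n))" for n :: nat
  have h: "0 < h n" "h n \<le> a - c" for n
    using c by (auto simp: h_def mult_le_cancel_left1 inverse_le_1_iff)
  have h0: "h \<longlonglongrightarrow> 0"
    unfolding h_def by (rule tendsto_mult_right_zero[OF LIMSEQ_inverse_real_of_nat])
  define \<phi> where "\<phi> n r = (G (r + h n) - G r) / h n" for n r
  define \<phi>' where "\<phi>' n r = (\<eta> (r + h n) - \<eta> r) / h n" for n r
  have \<phi>: "\<exists>z>r. z < r + h n \<and> \<phi> n r = \<eta> z" for n r
  proof -
    obtain z where "r < z" "z < r + h n" "G (r + h n) - G r = (r + h n - r) * \<eta> z"
      using MVT2[of r "r + h n" G \<eta>] G h by auto
    then show ?thesis
      using h[of n] by (auto simp: \<phi>_def)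
  qed
  have \<phi>_bd: "\<bar>\<phi> n r\<bar> \<le> B" for n r
    using \<phi>[of r n] B by auto
  have \<phi>_lim: "(\<lambda>n. \<phi> n r) \<longlonglongrightarrow> \<eta> r" for r
  proof (rule LIM_zero_cancel, rule Lim_null_comparison)
    show "\<forall>\<^sub>F n in sequentially. norm (\<phi> n r - \<eta> r) \<le> L * h n"
    proof (intro always_eventually allI)
      fix n
      obtain z where z: "r < z" "z < r + h n" "\<phi> n r = \<eta> z"
        using \<phi> by blast
      have "\<bar>\<phi> n r - \<eta> r\<bar> \<le> L * \<bar>z - r\<bar>"
        using z(3) L by simp
      also have "\<dots> \<le> L * h n"
        using z \<open>0 \<le> L\<close> by (intro mult_left_mono) auto
      finally show "norm (\<phi> n r - \<eta> r) \<le> L * h n"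
        by simp
    qed
    show "(\<lambda>n. L * h n) \<longlonglongrightarrow> 0"
      using tendsto_mult_right_zero[OF h0] by simp
  qed
  have \<phi>'_bd: "\<bar>\<phi>' n r\<bar> \<le> L" for n r
    using L[of "r + h n" r] h[of n] by (simp add: \<phi>'_def abs_divide pos_divide_le_eq)
  have \<phi>'_cont: "continuous_on UNIV (\<phi>' n)" for n
    unfolding \<phi>'_def by (intro continuous_intros continuous_on_compose2[OF cont]) (use h[of n] in auto)
  have \<phi>_deriv: "(\<phi> n has_real_derivative \<phi>' n r) (at r)" for n r
    unfolding \<phi>_def \<phi>'_def
    by (intro DERIV_cdivide DERIV_diff G DERIV_shift[THEN iffD1, OF G])
  have \<phi>_cont: "continuous_on UNIV (\<phi> n)" for n
    using DERIV_isCont[OF \<phi>_deriv] by (simp add: continuous_on_eq_continuous_at)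
  have "AE r in lebesgue. \<eta> differentiable (at r)"
    by (rule lipschitz_AE_differentiable[OF lip])
  then have \<phi>'_lim: "AE r in lebesgue. (\<lambda>n. \<phi>' n r) \<longlonglongrightarrow> deriv \<eta> r"
  proof eventually_elim
    case (elim r)
    then have "(\<eta> has_real_derivative deriv \<eta> r) (at r)"
      by (auto simp: real_differentiable_def DERIV_imp_deriv)
    then have "(\<lambda>h. (\<eta> (r + h) - \<eta> r) / h) \<midarrow>0\<rightarrow> deriv \<eta> r"
      by (simp add: DERIV_def)
    moreover have "filterlim h (at 0) sequentially"
      using h0 h by (auto simp: filterlim_at less_imp_neq[symmetric] intro!: always_eventually)
    ultimately show ?case
      unfolding \<phi>'_def by (rule filterlim_compose)
  qed
  obtain K1 where K1: "\<And>r. r \<in> {c..b} \<Longrightarrow> \<bar>w r\<bar> \<le> K1" "0 \<le> K1"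
    using bounded_on_Icc[OF c(1) w_cont] by metis
  obtain K2 where K2: "\<And>r. r \<in> {c..b} \<Longrightarrow> \<bar>V r\<bar> \<le> K2" "0 \<le> K2"
    using bounded_on_Icc[OF c(1) V_cont] by metis
  let ?s = "\<lambda>n r. indicator {c..b} r *\<^sub>R (w r * ((\<phi>' n r)\<^sup>2 - V r * (\<phi> n r)\<^sup>2))"
  let ?f = "\<lambda>r. indicator {c..b} r *\<^sub>R (w r * ((deriv \<eta> r)\<^sup>2 - V r * (\<eta> r)\<^sup>2))"
  let ?W = "\<lambda>r. indicator {c..b} r *\<^sub>R (K1 * (L\<^sup>2 + K2 * B\<^sup>2))"
  have s_int: "integrable lebesgue (?s n)" for n
    unfolding set_integrable_def[symmetric]
    by (intro set_integrable_lebesgue_continuous continuous_intros continuous_on_subset[OF w_cont]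
        continuous_on_subset[OF V_cont] continuous_on_subset[OF \<phi>_cont] continuous_on_subset[OF \<phi>'_cont])
       (use c in auto)
  have W_int: "integrable lebesgue ?W"
    unfolding set_integrable_def[symmetric] by (intro set_integrable_lebesgue_continuous continuous_intros)
  have lim: "AE r in lebesgue. (\<lambda>n. ?s n r) \<longlonglongrightarrow> ?f r"
    using \<phi>'_lim by eventually_elim (intro tendsto_intros \<phi>_lim)
  have bound: "norm (?s n r) \<le> ?W r" for n r
  proof (cases "r \<in> {c..b}")
    case True
    have "\<bar>(\<phi>' n r)\<^sup>2 - V r * (\<phi> n r)\<^sup>2\<bar> \<le> \<bar>(\<phi>' n r)\<^sup>2\<bar> + \<bar>V r\<bar> * \<bar>(\<phi> n r)\<^sup>2\<bar>"
      by (metis abs_mult abs_triangle_ineq4)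
    also have "\<dots> \<le> L\<^sup>2 + K2 * B\<^sup>2"
      using K2 True \<phi>_bd[of n r] \<phi>'_bd[of n r]
      by (intro add_mono mult_mono) (auto simp: abs_le_square_iff[symmetric] power2_le_iff_abs_le)
    finally have "\<bar>w r\<bar> * \<bar>(\<phi>' n r)\<^sup>2 - V r * (\<phi> n r)\<^sup>2\<bar> \<le> K1 * (L\<^sup>2 + K2 * B\<^sup>2)"
      using K1 True by (intro mult_mono) auto
    then show ?thesis
      using True by (simp add: abs_mult)
  qed auto
  define D where "D r = lim (\<lambda>n. ?s n r)" for r
  have [measurable]: "?s n \<in> borel_measurable lebesgue" for n
    using s_int by (rule borel_measurable_integrable)
  have "D \<in> borel_measurable lebesgue"
    unfolding D_def by measurable
  moreover have "AE r in lebesgue. D r = ?f r"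
    using lim by eventually_elim (simp add: D_def limI)
  ultimately have f_meas: "?f \<in> borel_measurable lebesgue"
    by (rule borel_measurable_AE)
  show "set_integrable lebesgue {c..b} (\<lambda>r. w r * ((deriv \<eta> r)\<^sup>2 - V r * (\<eta> r)\<^sup>2))"
    unfolding set_integrable_def
    by (rule integrable_dominated_convergence[OF f_meas borel_measurable_integrable[OF s_int] W_int lim])
       (use bound in auto)
  have conv: "(\<lambda>n. integral\<^sup>L lebesgue (?s n)) \<longlonglongrightarrow> integral\<^sup>L lebesgue ?f"
    by (rule integral_dominated_convergence[OF f_meas borel_measurable_integrable[OF s_int] W_int lim])
       (use bound in auto)
  have "0 \<le> integral\<^sup>L lebesgue (?s n)" for n
    unfolding set_lebesgue_integral_def[symmetric]
  proof (rule stable_C1[OF c(1) _ \<phi>_deriv \<phi>'_cont])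
    fix r assume r: "r \<notin> {c..b}"
    obtain z where z: "r < z" "z < r + h n" "\<phi> n r = \<eta> z"
      using \<phi> by blast
    then have "z \<notin> {a..b}"
      using r h[of n] by auto
    then show "\<phi> n r = 0"
      using z supp by simp
  qed (use c ab in auto)
  then show "0 \<le> (LINT r:{c..b}|lebesgue. w r * ((deriv \<eta> r)\<^sup>2 - V r * (\<eta> r)\<^sup>2))"
    unfolding set_lebesgue_integral_def by (intro LIMSEQ_le_const[OF conv]) auto
qed

end

section \<open>Removing the boundary condition at the right end\<close>

text \<open>For points on different sides the estimate goes through \<open>b\<close>, where the
  branches agree. Nothing is lost in the constant, since the two distances to \<open>b\<close> add
  up to the whole distance.\<close>

lemma lipschitz_on_glue:
  fixes f g :: "real \<Rightarrow> real"
  assumes f: "L-lipschitz_on (S \<inter> {..b}) f" and g: "M-lipschitz_on (S \<inter> {b..}) g"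
    and b: "b \<in> S" "f b = g b"
  shows "(max L M)-lipschitz_on S (\<lambda>x. if x \<le> b then f x else g x)"
proof -
  have f': "(max L M)-lipschitz_on (S \<inter> {..b}) f" and g': "(max L M)-lipschitz_on (S \<inter> {b..}) g"
    using f g by (auto intro: lipschitz_on_mono)
  have mixed: "dist (f x) (g y) \<le> max L M * dist x y" if "x \<in> S" "y \<in> S" "x \<le> b" "b < y" for x y
  proof -
    have "dist (f x) (g y) \<le> dist (f x) (f b) + dist (g b) (g y)"
      using b(2) dist_triangle by simp
    also have "\<dots> \<le> max L M * dist x b + max L M * dist b y"
      using that b by (intro add_mono lipschitz_onD[OF f'] lipschitz_onD[OF g']) auto
    also have "\<dots> = max L M * dist x y"
      using that by (simp add: dist_real_def algebra_simps)
    finally show ?thesis .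
  qed
  show ?thesis
  proof (rule lipschitz_onI)
    fix x y assume xy: "x \<in> S" "y \<in> S"
    show "dist (if x \<le> b then f x else g x) (if y \<le> b then f y else g y) \<le> max L M * dist x y"
      using xy lipschitz_onD[OF f', of x y] lipschitz_onD[OF g', of x y] mixed[of x y] mixed[of y x]
      by (auto simp: dist_commute)
  qed (use lipschitz_on_nonneg[OF f] in auto)
qed

lemma lipschitz_on_Icc_C1:
  fixes f :: "real \<Rightarrow> real"
  assumes "\<And>x. x \<in> {a..b} \<Longrightarrow> (f has_real_derivative f' x) (at x)" and "continuous_on {a..b} f'"
  obtains L where "L-lipschitz_on {a..b} f"
proof -
  have "bounded (f' ` {a..b})"
    using assms(2) by (intro compact_imp_bounded compact_continuous_image) auto
  then obtain K where K: "\<And>x. x \<in> {a..b} \<Longrightarrow> \<bar>f' x\<bar> \<le> K"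
    unfolding bounded_iff ball_simps real_norm_def by blast
  have "(max K 0)-lipschitz_on {a..b} f"
  proof (rule bounded_derivative_imp_lipschitz)
    fix x assume x: "x \<in> {a..b}"
    show "(f has_derivative (\<lambda>h. f' x * h)) (at x within {a..b})"
      using assms(1)[OF x] by (auto simp: has_field_derivative_def intro: has_derivative_at_withinI)
    show "onorm (\<lambda>h. f' x * h) \<le> max K 0"
      by (rule onorm_bound) (use K[OF x] in \<open>auto simp: abs_mult intro!: mult_right_mono\<close>)
  qed auto
  then show ?thesis by (rule that)
qed

text \<open>Completeness of \<open>lebesgue\<close> makes \<open>g\<close> measurable. Piecewise
  defined functions can therefore be compared off their break points, where \<open>deriv\<close> may
  be meaningless.\<close>

lemma set_integral_AE_cong_lebesgue:
  fixes f g :: "'a::euclidean_space \<Rightarrow> real"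
  assumes f: "set_integrable lebesgue A f" and eq: "AE x in lebesgue. x \<in> A \<longrightarrow> f x = g x"
  shows "set_integrable lebesgue A g" "(LINT x:A|lebesgue. g x) = (LINT x:A|lebesgue. f x)"
proof -
  have ae: "AE x in lebesgue. indicator A x *\<^sub>R f x = indicator A x *\<^sub>R g x"
    using eq by eventually_elim (auto simp: indicator_def)
  have f_meas: "(\<lambda>x. indicator A x *\<^sub>R f x) \<in> borel_measurable lebesgue"
    using f unfolding set_integrable_def by (rule borel_measurable_integrable)
  have g_meas: "(\<lambda>x. indicator A x *\<^sub>R g x) \<in> borel_measurable lebesgue"
    using f_meas ae by (rule borel_measurable_AE)
  show "set_integrable lebesgue A g"
    using f g_meas ae unfolding set_integrable_def by (rule integrable_cong_AE_imp)
  show "(LINT x:A|lebesgue. g x) = (LINT x:A|lebesgue. f x)"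
    unfolding set_lebesgue_integral_def
    by (rule integral_cong_AE[symmetric, OF f_meas g_meas ae])
qed

lemma AE_lebesgue_neq: "AE x in lebesgue. x \<noteq> (c::real)"
  using AE_lborel_singleton by (rule AE_completion)

lemma deriv_eq_on_open:
  assumes "open S" "x \<in> S" "\<And>y. y \<in> S \<Longrightarrow> f y = g y"
  shows "deriv f x = deriv g x"
  using assms by (intro deriv_cong_ev) (auto simp: eventually_nhds)

locale weighted_stable_HS = weighted_stable +
  assumes HS: "\<And>R1. R1 \<ge> 1 \<Longrightarrow> \<exists>R2>R1. \<exists>\<eta>. (\<exists>L. L-lipschitz_on {R1..R2} \<eta>) \<and> \<eta> R2 = 0 \<and>
    (LINT r:{R1..R2}|lebesgue. w r * ((deriv \<eta> r)\<^sup>2 - V r * (\<eta> r)\<^sup>2)) < 0"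
begin

abbreviation energy :: "(real \<Rightarrow> real) \<Rightarrow> real \<Rightarrow> real" where
  "energy \<eta> r \<equiv> w r * ((deriv \<eta> r)\<^sup>2 - V r * (\<eta> r)\<^sup>2)"

text \<open>The test function follows \<open>\<zeta>\<close> up to \<open>R1\<close>, then
  \<open>k * \<eta>\<close> up to \<open>R2\<close>, and is zero afterwards; the condition on
  \<open>k\<close> makes it continuous. Its energy is additive over the two pieces and quadratic in
  \<open>k\<close>.\<close>

lemma stable_glued:
  assumes a: "1 < a" "a < R1" "R1 < R2" and c: "1 < c" "c < a"
    and lip: "L-lipschitz_on UNIV \<zeta>" and supp: "\<And>r. r \<le> a \<Longrightarrow> \<zeta> r = 0"
    and \<eta>: "M-lipschitz_on {R1..R2} \<eta>" "\<eta> R2 = 0" and k: "k * \<eta> R1 = \<zeta> R1"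
  shows "set_integrable lebesgue {c..R1} (energy \<zeta>)"
    and "0 \<le> (LINT r:{c..R1}|lebesgue. energy \<zeta> r) + k\<^sup>2 * (LINT r:{R1..R2}|lebesgue. energy \<eta> r)"
proof -
  define g where "g r = (if r \<le> R2 then k * \<eta> r else 0)" for r
  define \<rho> where "\<rho> r = (if r \<le> R1 then \<zeta> r else g r)" for r
  have "(max (\<bar>k\<bar> * M) 0)-lipschitz_on {R1..} g"
    unfolding g_def using \<eta> a
    by (intro lipschitz_on_glue lipschitz_on_cmult_real lipschitz_on_constant)
       (auto elim: lipschitz_on_subset)
  then have \<rho>_lip: "(max L (max (\<bar>k\<bar> * M) 0))-lipschitz_on UNIV \<rho>"
    unfolding \<rho>_def using lip a k
    by (intro lipschitz_on_glue) (auto simp: g_def elim: lipschitz_on_subset)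
  have \<rho>_supp: "\<rho> r = 0" if "r \<notin> {a..R2}" for r
    using that a supp[of r] by (auto simp: \<rho>_def g_def)
  note st = stable_lipschitz[OF a(1) less_trans[OF a(2,3)] \<rho>_lip \<rho>_supp c]
  have 1: "set_integrable lebesgue {c..R1} (energy \<rho>)" "set_integrable lebesgue {R1..R2} (energy \<rho>)"
    using a c by (auto intro: set_integrable_subset[OF st(1)])
  have "{c..R2} = {c..R1} \<union> {R1..R2}"
    using a c by auto
  then have "(LINT r:{c..R2}|lebesgue. energy \<rho> r) =
      (LINT r:{c..R1}|lebesgue. energy \<rho> r) + (LINT r:{R1..R2}|lebesgue. energy \<rho> r)"
    using AE_lebesgue_neq[of R1] by (auto intro!: set_integral_Un_AE 1)
  with st(2) have 2: "0 \<le> (LINT r:{c..R1}|lebesgue. energy \<rho> r) + (LINT r:{R1..R2}|lebesgue. energy \<rho> r)"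
    by simp
  have eq1: "AE r in lebesgue. r \<in> {c..R1} \<longrightarrow> energy \<rho> r = energy \<zeta> r"
    using AE_lebesgue_neq[of R1]
  proof eventually_elim
    case (elim r)
    have "deriv \<rho> r = deriv \<zeta> r" if "r < R1"
      by (rule deriv_eq_on_open[of "{..<R1}"]) (use that in \<open>auto simp: \<rho>_def\<close>)
    then show ?case
      using elim by (auto simp: \<rho>_def)
  qed
  have eq2: "AE r in lebesgue. r \<in> {R1..R2} \<longrightarrow> energy \<rho> r = k\<^sup>2 * energy \<eta> r"
    using AE_lebesgue_neq[of R1] AE_lebesgue_neq[of R2] lipschitz_AE_differentiable[OF \<rho>_lip]
  proof eventually_elim
    case (elim r)
    have "energy \<rho> r = k\<^sup>2 * energy \<eta> r" if r: "R1 < r" "r < R2"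
    proof -
      have near: "\<rho> y = k * \<eta> y" if "y \<in> {R1<..<R2}" for y
        using that by (auto simp: \<rho>_def g_def)
      have "deriv \<rho> r = k * deriv \<eta> r"
      \<comment> \<open>Differentiability of \<open>\<eta>\<close> itself is not at hand. For
        nonzero \<open>k\<close> it is inherited from \<open>\<rho>\<close> after division by
        \<open>k\<close>; for \<open>k = 0\<close> both sides vanish, whatever value
        \<open>deriv \<eta> r\<close> has.\<close>
      proof (cases "k = 0")
        case True
        have "deriv \<rho> r = deriv (\<lambda>_. 0) r"
          by (rule deriv_eq_on_open[of "{R1<..<R2}"]) (use r near True in auto)
        with True show ?thesis by simp
      next
        case False
        obtain D where D: "(\<rho> has_real_derivative D) (at r)"
          using elim by (auto simp: real_differentiable_def)
        then have "((\<lambda>y. inverse k * \<rho> y) has_real_derivative inverse k * D) (at r)"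
          by (rule DERIV_cmult)
        then have "(\<eta> has_real_derivative inverse k * D) (at r)"
          by (rule has_field_derivative_transform_within_open[of _ _ _ "{R1<..<R2}"])
             (use r near False in auto)
        then show ?thesis
          using D False by (simp add: DERIV_imp_deriv)
      qed
      then show ?thesis
        using near[of r] r by (simp add: power_mult_distrib algebra_simps)
    qed
    then show ?case
      using elim by auto
  qed
  note cong1 = set_integral_AE_cong_lebesgue[OF 1(1) eq1]
  note cong2 = set_integral_AE_cong_lebesgue[OF 1(2) eq2]
  show "set_integrable lebesgue {c..R1} (energy \<zeta>)"
    by (rule cong1(1))
  show "0 \<le> (LINT r:{c..R1}|lebesgue. energy \<zeta> r) + k\<^sup>2 * (LINT r:{R1..R2}|lebesgue. energy \<eta> r)"
    using 2 cong1(2) cong2(2) by simp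
qed

lemma stable_free_end:
  assumes a: "1 < a" "a < R1" and c: "1 < c" "c < a"
    and lip: "L-lipschitz_on UNIV \<zeta>" and supp: "\<And>r. r \<le> a \<Longrightarrow> \<zeta> r = 0"
  shows "set_integrable lebesgue {c..R1} (energy \<zeta>)"
    and "0 \<le> (LINT r:{c..R1}|lebesgue. energy \<zeta> r)"
proof -
  obtain R2 \<eta> M where R2: "R1 < R2" and \<eta>: "M-lipschitz_on {R1..R2} \<eta>" "\<eta> R2 = 0"
    and neg: "(LINT r:{R1..R2}|lebesgue. energy \<eta> r) < 0"
    using HS[of R1] a by auto
  \<comment> \<open>Otherwise \<open>\<eta>\<close>, extended by zero on both sides, would be an
    admissible function of negative energy. In the gluing lemma this is the case of the zero
    function on the left and \<open>k = 1\<close>.\<close>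
  have "\<eta> R1 \<noteq> 0"
  proof
    assume "\<eta> R1 = 0"
    then have "0 \<le> (LINT r:{c..R1}|lebesgue. energy (\<lambda>_. 0) r) + 1\<^sup>2 * (LINT r:{R1..R2}|lebesgue. energy \<eta> r)"
      by (intro stable_glued[OF a R2 c _ _ \<eta>, where L = 0]) (auto intro: lipschitz_on_constant)
    with neg show False by simp
  qed
  then have k: "\<zeta> R1 / \<eta> R1 * \<eta> R1 = \<zeta> R1" by simp
  note gl = stable_glued[OF a R2 c lip supp \<eta> k]
  show "set_integrable lebesgue {c..R1} (energy \<zeta>)"
    by (rule gl(1))
  have "(\<zeta> R1 / \<eta> R1)\<^sup>2 * (LINT r:{R1..R2}|lebesgue. energy \<eta> r) \<le> 0"
    using neg by (intro mult_nonneg_nonpos) auto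
  with gl(2) show "0 \<le> (LINT r:{c..R1}|lebesgue. energy \<zeta> r)"
    by linarith
qed

end

section \<open>Energy decay\<close>

locale weighted_stable_HS_power = weighted_stable_HS w "\<lambda>r. s\<^sup>2 / r\<^sup>2" for w :: "real \<Rightarrow> real" and s :: real +
  assumes s_nonneg: "0 \<le> s"
begin

text \<open>The test function is r^s multiplied by a linear ramp on
  \<open>[a, a + \<epsilon>]\<close>, then r^s up to \<open>r0\<close>, then the constant r0^s. The
  ramp costs at most slope squared times \<open>w\<close>, the middle piece has zero energy, and the
  constant piece contributes exactly the negative of the left-hand side. The bound does not depend
  on \<open>R\<close>.\<close>

lemma energy_decay:
  assumes a: "1 < a" and \<epsilon>: "0 < \<epsilon>" "\<epsilon> \<le> 1" and r0: "a + 1 \<le> r0" "r0 < R"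
  shows "r0 powr (2 * s) * (LINT r:{r0..R}|lebesgue. w r * (s\<^sup>2 / r\<^sup>2))
    \<le> ((1 + s) * (a + 1) powr s / \<epsilon>)\<^sup>2 * (LINT r:{a..a+\<epsilon>}|lebesgue. w r)"
proof -
  define c where "c = (1 + a) / 2"
  have c: "1 < c" "c < a" using a by (auto simp: c_def)
  \<comment> \<open>A bound for the derivative of the ramp \<open>p\<close>: there 1 < r < a + 1 and
    (r - a) / \<epsilon> is at most 1 / \<epsilon>, and both r^s and r^(s-1) are at most (a +
    1)^s.\<close>
  define K where "K = (1 + s) * (a + 1) powr s / \<epsilon>"
  define p where "p r = (r - a) / \<epsilon> * r powr s" for r
  define p' where "p' r = r powr s / \<epsilon> + (r - a) / \<epsilon> * (s * r powr (s - 1))" for r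
  define \<zeta>1 where "\<zeta>1 r = (if r \<le> r0 then r powr s else r0 powr s)" for r
  define \<zeta>2 where "\<zeta>2 r = (if r \<le> a + \<epsilon> then p r else \<zeta>1 r)" for r
  define \<zeta> where "\<zeta> r = (if r \<le> a then 0 else \<zeta>2 r)" for r
  have p_deriv: "(p has_real_derivative p' r) (at r)" if "0 < r" for r
    unfolding p_def p'_def
    by (rule derivative_eq_intros refl | use that \<epsilon> in \<open>simp add: field_simps\<close>)+
  have pow_deriv: "((\<lambda>r. r powr s) has_real_derivative s * r powr (s - 1)) (at r)" if "0 < r" for r
    using has_real_derivative_powr[OF that] .
  have "continuous_on {a..a+\<epsilon>} p'" "continuous_on {a+\<epsilon>..r0} (\<lambda>r. s * r powr (s - 1))"
    unfolding p'_def using a \<epsilon> by (auto intro!: continuous_intros)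
  then obtain L1 L2 where L1: "L1-lipschitz_on {a..a+\<epsilon>} p" and L2: "L2-lipschitz_on {a+\<epsilon>..r0} (\<lambda>r. r powr s)"
    using lipschitz_on_Icc_C1[of a "a + \<epsilon>" p p'] p_deriv
      lipschitz_on_Icc_C1[of "a + \<epsilon>" r0 "\<lambda>r. r powr s" "\<lambda>r. s * r powr (s - 1)"] pow_deriv a \<epsilon>
    by (metis atLeastAtMost_iff add_pos_pos less_le_trans less_trans zero_less_one)
  have "(max L2 0)-lipschitz_on {a+\<epsilon>..} \<zeta>1"
    unfolding \<zeta>1_def using r0 \<epsilon>
    by (intro lipschitz_on_glue lipschitz_on_constant) (auto intro: lipschitz_on_subset[OF L2])
  then have "(max L2 0)-lipschitz_on ({a..} \<inter> {a+\<epsilon>..}) \<zeta>1"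
    by (rule lipschitz_on_subset) auto
  moreover have "L1-lipschitz_on ({a..} \<inter> {..a+\<epsilon>}) p"
    by (rule lipschitz_on_subset[OF L1]) auto
  moreover have "p (a + \<epsilon>) = \<zeta>1 (a + \<epsilon>)"
    using \<epsilon> r0 by (simp add: p_def \<zeta>1_def)
  ultimately have "(max L1 (max L2 0))-lipschitz_on {a..} \<zeta>2"
    unfolding \<zeta>2_def using \<epsilon> by (intro lipschitz_on_glue) auto
  then have lip: "(max 0 (max L1 (max L2 0)))-lipschitz_on UNIV \<zeta>"
    unfolding \<zeta>_def using \<epsilon>
    by (intro lipschitz_on_glue lipschitz_on_constant) (auto elim: lipschitz_on_subset simp: p_def \<zeta>2_def)
  have supp: "\<zeta> r = 0" if "r \<le> a" for r
    using that by (simp add: \<zeta>_def)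
  have "a < R" using r0 by simp
  note st = stable_free_end[OF a this c lip supp]
  let ?ramp = "\<lambda>r. K\<^sup>2 * (indicator {a..a+\<epsilon>} r * w r)"
  let ?tail = "\<lambda>r. r0 powr (2 * s) * (indicator {r0..R} r * (w r * (s\<^sup>2 / r\<^sup>2)))"
  \<comment> \<open>The estimate is stated on the whole interval, with indicators selecting ramp and
    tail, so that a single monotonicity argument for integrals suffices. The three break points form
    a null set.\<close>
  have bound: "AE r in lebesgue. r \<in> {c..R} \<longrightarrow> energy \<zeta> r \<le> ?ramp r - ?tail r"
    using AE_lebesgue_neq[of a] AE_lebesgue_neq[of "a + \<epsilon>"] AE_lebesgue_neq[of r0]
  proof eventually_elim
    case (elim r)
    show ?case
    proof (intro impI)
      assume r: "r \<in> {c..R}"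
      then have w: "0 \<le> w r" using c by (intro w_nonneg) auto
      consider "r < a" | "a < r" "r < a + \<epsilon>" | "a + \<epsilon> < r" "r < r0" | "r0 < r"
        using elim by linarith
      then show "energy \<zeta> r \<le> ?ramp r - ?tail r"
      proof cases
        case 1
        have "deriv \<zeta> r = deriv (\<lambda>_. 0) r"
          by (rule deriv_eq_on_open[of "{..<a}"]) (use 1 in \<open>auto simp: \<zeta>_def\<close>)
        then show ?thesis
          using 1 \<epsilon> r0 by (simp add: \<zeta>_def)
      next
        case 2
        have "deriv \<zeta> r = deriv p r"
          by (rule deriv_eq_on_open[of "{a<..<a+\<epsilon>}"]) (use 2 in \<open>auto simp: \<zeta>_def \<zeta>2_def\<close>)
        also have "\<dots> = p' r"
          using p_deriv[of r] 2 a by (intro DERIV_imp_deriv) auto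
        finally have d: "deriv \<zeta> r = p' r" .
        have pow: "r powr s \<le> (a + 1) powr s"
          using 2 a \<epsilon> s_nonneg by (intro powr_mono2) auto
        have "r powr (s - 1) \<le> r powr s"
          using 2 a by (intro powr_mono) auto
        with pow have pow': "r powr (s - 1) \<le> (a + 1) powr s" by linarith
        have "(r - a) / \<epsilon> * (s * r powr (s - 1)) \<le> (1 / \<epsilon>) * (s * (a + 1) powr s)"
          using 2 a \<epsilon> s_nonneg pow' by (intro mult_mono divide_right_mono) auto
        moreover have "r powr s / \<epsilon> \<le> (a + 1) powr s / \<epsilon>"
          using pow \<epsilon> by (intro divide_right_mono) auto
        moreover have "K = (a + 1) powr s / \<epsilon> + 1 / \<epsilon> * (s * (a + 1) powr s)"
          by (simp add: K_def distrib_right add_divide_distrib)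
        ultimately have "p' r \<le> K"
          unfolding p'_def by linarith
        moreover have "0 \<le> p' r"
          unfolding p'_def using 2 a \<epsilon> s_nonneg by (intro add_nonneg_nonneg mult_nonneg_nonneg) auto
        ultimately have "(p' r)\<^sup>2 \<le> K\<^sup>2"
          by (rule power_mono)
        moreover have "0 \<le> s\<^sup>2 / r\<^sup>2 * (\<zeta> r)\<^sup>2"
          by (intro mult_nonneg_nonneg divide_nonneg_nonneg) auto
        ultimately have "energy \<zeta> r \<le> w r * K\<^sup>2"
          unfolding d using w by (intro mult_left_mono) linarith+
        then show ?thesis
          using 2 r0 \<epsilon> by (simp add: mult.commute)
      next
        case 3
        have eq: "\<zeta> y = y powr s" if "y \<in> {a+\<epsilon><..<r0}" for y
          using that \<epsilon> by (auto simp: \<zeta>_def \<zeta>2_def \<zeta>1_def)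
        have "deriv \<zeta> r = deriv (\<lambda>r. r powr s) r"
          by (rule deriv_eq_on_open[of "{a+\<epsilon><..<r0}"]) (use 3 eq in auto)
        also have "\<dots> = s * r powr (s - 1)"
          using pow_deriv[of r] 3 a \<epsilon> by (intro DERIV_imp_deriv) auto
        finally have "deriv \<zeta> r = s * (r powr s / r)"
          using 3 a \<epsilon> by (simp add: powr_diff)
        then have "energy \<zeta> r = 0"
          using eq[of r] 3 by (simp add: power_mult_distrib power_divide)
        moreover have "?ramp r - ?tail r = 0"
          using 3 by simp
        ultimately show ?thesis by linarith
      next
        case 4
        have eq: "\<zeta> y = r0 powr s" if "y \<in> {r0<..}" for y
          using that \<epsilon> r0 by (auto simp: \<zeta>_def \<zeta>2_def \<zeta>1_def)
        have "deriv \<zeta> r = deriv (\<lambda>_. r0 powr s) r"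
          by (rule deriv_eq_on_open[of "{r0<..}"]) (use 4 eq in auto)
        moreover have "(r0 powr s)\<^sup>2 = r0 powr (2 * s)"
          using a r0 by (simp add: powr_power mult.commute)
        ultimately show ?thesis
          using 4 eq[of r] r r0 \<epsilon> by (simp add: mult_ac)
      qed
    qed
  qed
  have w_int: "set_integrable lebesgue {c..R} (\<lambda>r. indicator {x..y} r * g r)"
    if "c \<le> x" "y \<le> R" "continuous_on {1<..} g" for x y and g :: "real \<Rightarrow> real"
  proof -
    have "set_integrable lebesgue {x..y} g"
      using that c by (intro set_integrable_lebesgue_continuous continuous_on_subset[OF that(3)]) auto
    then show ?thesis
      unfolding set_integrable_def
      by (rule back_subst[of "integrable lebesgue"]) (use that in \<open>auto simp: indicator_def\<close>)
  qed
  have w_LINT: "(LINT r:{c..R}|lebesgue. indicator {x..y} r * g r) = (LINT r:{x..y}|lebesgue. g r)"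
    if "c \<le> x" "y \<le> R" for x y and g :: "real \<Rightarrow> real"
    unfolding set_lebesgue_integral_def
    by (rule Bochner_Integration.integral_cong) (use that in \<open>auto simp: indicator_def\<close>)
  have wV_cont: "continuous_on {1<..} (\<lambda>r. w r * (s\<^sup>2 / r\<^sup>2))"
    by (intro continuous_intros w_cont V_cont) auto
  have bds: "c \<le> a" "a + \<epsilon> \<le> R" "c \<le> r0" "R \<le> R"
    using c r0 \<epsilon> by auto
  have int: "set_integrable lebesgue {c..R} ?ramp" "set_integrable lebesgue {c..R} ?tail"
    by (intro set_integrable_mult_right w_int bds w_cont wV_cont)+
  have "0 \<le> (LINT r:{c..R}|lebesgue. energy \<zeta> r)"
    by (rule st(2))
  also have "\<dots> \<le> (LINT r:{c..R}|lebesgue. ?ramp r - ?tail r)"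
    by (rule set_integral_mono_AE[OF st(1)]) (use bound int in \<open>auto intro: set_integral_diff\<close>)
  also have "\<dots> = K\<^sup>2 * (LINT r:{a..a+\<epsilon>}|lebesgue. w r)
      - r0 powr (2 * s) * (LINT r:{r0..R}|lebesgue. w r * (s\<^sup>2 / r\<^sup>2))"
    by (subst set_integral_diff(2)[OF int]) (simp only: set_integral_mult_right w_LINT bds)
  finally show ?thesis
    by (simp add: K_def)
qed

end

section \<open>Limits and dyadic sums\<close>

lemma mono_imp_ereal_limit_at_top:
  fixes g :: "real \<Rightarrow> real"
  assumes mono: "\<And>x y. a \<le> x \<Longrightarrow> x \<le> y \<Longrightarrow> g x \<le> g y"
  shows "((\<lambda>r. ereal (g r)) \<longlongrightarrow> (SUP r\<in>{a..}. ereal (g r))) at_top"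
proof (rule order_tendstoI)
  fix y assume "y < (SUP r\<in>{a..}. ereal (g r))"
  then obtain x where x: "a \<le> x" "y < ereal (g x)"
    by (auto simp: less_SUP_iff)
  show "\<forall>\<^sub>F r in at_top. y < ereal (g r)"
    using eventually_ge_at_top[of x]
  proof eventually_elim
    case (elim r)
    then have "ereal (g x) \<le> ereal (g r)"
      using mono x by simp
    with x(2) show ?case by (rule less_le_trans)
  qed
next
  fix y assume y: "(SUP r\<in>{a..}. ereal (g r)) < y"
  show "\<forall>\<^sub>F r in at_top. ereal (g r) < y"
    using eventually_ge_at_top[of a]
  proof eventually_elim
    case (elim r)
    then have "ereal (g r) \<le> (SUP r\<in>{a..}. ereal (g r))"
      by (intro SUP_upper) auto
    with y show ?case by (rule le_less_trans[rotated])
  qed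
qed

text \<open>If \<open>U'\<close> has a zero, then \<open>U\<close> is eventually constant by
  hypothesis. If it has none, connectedness of its image fixes its sign, and \<open>U\<close> is
  monotone.\<close>

lemma ereal_limit_at_top_if_deriv_sign:
  fixes U :: "real \<Rightarrow> real"
  assumes deriv: "\<And>r. b < r \<Longrightarrow> (U has_real_derivative U' r) (at r)"
    and cont: "continuous_on {b<..} U'"
    and zero: "\<And>a. b < a \<Longrightarrow> U' a = 0 \<Longrightarrow> \<exists>c>b. \<forall>r\<ge>c. U' r = 0"
  shows "\<exists>l. ((\<lambda>r. ereal (U r)) \<longlongrightarrow> l) at_top"
proof -
  have up: "\<exists>l. ((\<lambda>r. ereal (g r)) \<longlongrightarrow> l) at_top"
    if g: "\<And>r. c \<le> r \<Longrightarrow> (g has_real_derivative g' r) (at r)" "\<And>r. c \<le> r \<Longrightarrow> 0 \<le> g' r" for g g' c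
  proof (rule exI, rule mono_imp_ereal_limit_at_top[of c])
    fix x y assume "c \<le> x" "x \<le> y"
    then show "g x \<le> g y"
      using g by (intro DERIV_nonneg_imp_nondecreasing[of x y g]) (meson order_trans)+
  qed
  consider a where "b < a" "U' a = 0" | "\<And>r. b < r \<Longrightarrow> 0 < U' r" | "\<And>r. b < r \<Longrightarrow> U' r < 0"
  proof (cases "\<exists>a>b. U' a = 0")
    case False
    have conn: "connected (U' ` {b<..})"
      by (intro connected_continuous_image cont) auto
    have "\<not> (0 < U' x \<and> U' y < 0)" if "b < x" "b < y" for x y
    proof
      assume "0 < U' x \<and> U' y < 0"
      then have "0 \<in> U' ` {b<..}"
        using connectedD_interval[OF conn, of "U' y" "U' x" 0] that by auto
      with False show False by auto
    qed
    with False that show ?thesis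
      by (metis linorder_neqE_linordered_idom)
  qed (use that in auto)
  then show ?thesis
  proof cases
    case 1
    then obtain c where c: "c > b" "\<And>r. r \<ge> c \<Longrightarrow> U' r = 0"
      using zero by blast
    show ?thesis
      by (rule up[of c U U'], rule deriv) (use c in simp_all)
  next
    case 2
    show ?thesis
      by (rule up[of "b + 1" U U']) (use deriv 2 in \<open>auto intro!: less_imp_le[OF 2]\<close>)
  next
    case 3
    have "\<exists>l. ((\<lambda>r. ereal (- U r)) \<longlongrightarrow> l) at_top"
      by (rule up[of "b + 1" "\<lambda>r. - U r" "\<lambda>r. - U' r"])
         (use deriv in \<open>auto intro!: less_imp_le[OF 3] DERIV_minus\<close>)
    then obtain l where "((\<lambda>r. - ereal (U r)) \<longlongrightarrow> l) at_top" by auto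
    then have "((\<lambda>r. - (- ereal (U r))) \<longlongrightarrow> - l) at_top"
      by (rule tendsto_uminus_ereal)
    then show ?thesis by auto
  qed
qed

text \<open>The increments over r, 2r, 4r, ... are dominated by a geometric series of ratio q =
  2^\<beta> < 1. Its sum X = K / (1 - q) satisfies q X + K = X, so the induction on the number of
  doublings closes with one and the same constant.\<close>

lemma dyadic_sum_bound:
  fixes U :: "real \<Rightarrow> real"
  assumes step: "\<And>r t. r1 \<le> r \<Longrightarrow> r \<le> t \<Longrightarrow> t \<le> 2 * r \<Longrightarrow> \<bar>U t - U r\<bar> \<le> K * r powr \<beta>"
    and \<beta>: "\<beta> < 0" and r: "0 < r1" "r1 \<le> r" "r \<le> t"
  shows "\<bar>U t - U r\<bar> \<le> K / (1 - 2 powr \<beta>) * r powr \<beta>"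
proof -
  define q :: real where "q = 2 powr \<beta>"
  have q: "0 < q" "q < 1"
    using \<beta> by (auto simp: q_def powr_less_one)
  have "0 \<le> K * r1 powr \<beta>"
    using step[of r1 r1] r by auto
  then have "0 \<le> K"
    using r by (simp add: zero_le_mult_iff)
  have main: "\<forall>r\<ge>r1. \<forall>t. r \<le> t \<and> t \<le> 2 ^ k * r \<longrightarrow> \<bar>U t - U r\<bar> \<le> K / (1 - q) * r powr \<beta>" for k
  proof (induction k)
    case 0
    then show ?case using q \<open>0 \<le> K\<close> by auto
  next
    case (Suc k)
    show ?case
    proof (intro allI impI)
      fix r t assume r': "r1 \<le> r" and t: "r \<le> t \<and> t \<le> 2 ^ Suc k * r"
      show "\<bar>U t - U r\<bar> \<le> K / (1 - q) * r powr \<beta>"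
      proof (cases "t \<le> 2 * r")
        case True
        have "\<bar>U t - U r\<bar> \<le> K * r powr \<beta>"
          using step r' t True by auto
        also have "\<dots> \<le> K / (1 - q) * r powr \<beta>"
          using q \<open>0 \<le> K\<close> by (intro mult_right_mono) (auto simp: field_simps)
        finally show ?thesis .
      next
        case False
        have "\<bar>U t - U (2 * r)\<bar> \<le> K / (1 - q) * (2 * r) powr \<beta>"
          using Suc.IH[rule_format, of "2 * r" t] False t r' r by (auto simp: algebra_simps)
        also have "(2 * r) powr \<beta> = q * r powr \<beta>"
          using r r' by (simp add: q_def powr_mult)
        finally have "\<bar>U t - U (2 * r)\<bar> \<le> K / (1 - q) * (q * r powr \<beta>)" .
        moreover have "\<bar>U (2 * r) - U r\<bar> \<le> K * r powr \<beta>"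
          using step r' r by auto
        moreover have "K / (1 - q) * (q * r powr \<beta>) + K * r powr \<beta> = K / (1 - q) * r powr \<beta>"
          using q by (simp add: field_simps)
        ultimately show ?thesis by linarith
      qed
    qed
  qed
  obtain k where "t / r < 2 ^ k"
    using real_arch_pow[of 2 "t / r"] by auto
  then show ?thesis
    using main[of k] r by (auto simp: q_def field_simps)
qed

text \<open>Without decay of the increments the doublings are merely counted. Their number is log_2
  t rounded up, which accounts for the summand 1; counting from 1 instead of \<open>r1\<close> is
  enough because \<open>1 \<le> r1\<close>.\<close>

lemma dyadic_count_bound:
  fixes U :: "real \<Rightarrow> real"
  assumes step: "\<And>r t. r1 \<le> r \<Longrightarrow> r \<le> t \<Longrightarrow> t \<le> 2 * r \<Longrightarrow> \<bar>U t - U r\<bar> \<le> K"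
    and r1: "1 \<le> r1" "r1 \<le> t"
  shows "\<bar>U t - U r1\<bar> \<le> K * (ln t / ln 2 + 1)"
proof -
  have "0 \<le> K"
    using step[of r1 r1] r1 by auto
  have main: "\<forall>t. r1 \<le> t \<and> t \<le> 2 ^ k * r1 \<longrightarrow> \<bar>U t - U r1\<bar> \<le> K * real k" for k
  proof (induction k)
    case (Suc k)
    show ?case
    proof (intro allI impI)
      fix t assume t: "r1 \<le> t \<and> t \<le> 2 ^ Suc k * r1"
      \<comment> \<open>The last doubling is split off, going from \<open>m\<close> to
        \<open>t\<close>. The maximum prevents the intermediate point from falling below
        \<open>r1\<close>.\<close>
      define m where "m = max r1 (t / 2)"
      have "1 \<le> (2::real) ^ k" by simp
      then have "r1 \<le> 2 ^ k * r1"
        using r1 by (simp add: mult_le_cancel_right1)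
      then have "\<bar>U m - U r1\<bar> \<le> K * real k"
        using Suc.IH t by (auto simp: m_def)
      moreover have "\<bar>U t - U m\<bar> \<le> K"
        using t r1 by (intro step) (auto simp: m_def)
      ultimately show "\<bar>U t - U r1\<bar> \<le> K * real (Suc k)"
        by (simp add: algebra_simps)
    qed
  qed auto
  define k where "k = nat \<lceil>log 2 t\<rceil>"
  have "0 \<le> log 2 t" using r1 by auto
  then have k: "log 2 t \<le> real k" "real k \<le> log 2 t + 1"
    by (auto simp: k_def)
  have "t = 2 powr (log 2 t)" using r1 by auto
  also have "\<dots> \<le> 2 powr real k"
    using k by (intro powr_mono) auto
  also have "\<dots> = 2 ^ k"
    by (simp add: powr_realpow)
  also have "\<dots> \<le> 2 ^ k * r1"
    using r1 by (simp add: mult_le_cancel_left1)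
  finally have "\<bar>U t - U r1\<bar> \<le> K * real k"
    using main r1 by auto
  also have "\<dots> \<le> K * (ln t / ln 2 + 1)"
    using k \<open>0 \<le> K\<close> by (intro mult_left_mono) (auto simp: log_def)
  finally show ?thesis .
qed

section \<open>Asymptotics of the profile\<close>

text \<open>This plays the part of Cauchy-Schwarz on \<open>[r, 2r]\<close>, in the pointwise form
  of AM-GM. Both resulting terms turn out to be the same power of r, one with a factor proportional
  to \<open>C\<close>, the other with a factor independent of \<open>C\<close>.\<close>

lemma increment_le_weighted_energy:
  fixes U U' :: "real \<Rightarrow> real" and N :: nat
  assumes dU: "\<And>x. 1 < x \<Longrightarrow> (U has_real_derivative U' x) (at x)" and cont: "continuous_on {1<..} U'"
    and N: "1 \<le> N" and s: "0 < s" and r: "1 < r" "r \<le> t" "t \<le> 2 * r"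
    and decay: "r powr (2 * s) * (LINT x:{r..2*r}|lebesgue. x ^ (N - 1) * (U' x)\<^sup>2 * (s\<^sup>2 / x\<^sup>2)) \<le> C"
  shows "\<bar>U t - U r\<bar> \<le> (4 * C / s\<^sup>2 + 1) / 2 * r powr (2 - real N / 2 - s)"
proof -
  define q where "q x = x ^ (N - 1) * (U' x)\<^sup>2 * (s\<^sup>2 / x\<^sup>2)" for x
  \<comment> \<open>The weight in \<open>2 \<bar>U'\<bar> \<le> l U'\<^sup>2 + 1 / l\<close> that balances the two integrals over \<open>[r, 2r]\<close>\<close>
  define l where "l = r powr (real N / 2 - 1 + s)"
  define m where "m = r powr (3 - real N)"
  have pos: "0 < l" "0 < m" using r by (auto simp: l_def m_def)
  define g where "g x = (l * (4 / s\<^sup>2 * m * q x) + 1 / l) / 2" for x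
  have q_cont: "continuous_on {r..2*r} q"
    unfolding q_def using r by (intro continuous_intros continuous_on_subset[OF cont]) auto
  then have q_int: "q integrable_on {r..2*r}"
    by (rule integrable_continuous_real)
  have g_int: "g integrable_on {r..2*r}"
    unfolding g_def by (intro integrable_continuous_real continuous_intros q_cont) (use pos in auto)
  have g_ge: "\<bar>U' x\<bar> \<le> g x" if x: "x \<in> {r..2*r}" for x
  proof -
    have "r powr (real N - 1) = r ^ (N - 1)"
      using r N by (simp add: powr_realpow[symmetric] of_nat_diff)
    moreover have "m = r powr (2 - (real N - 1))"
      by (simp add: m_def)
    ultimately have m': "m = r\<^sup>2 / r ^ (N - 1)"
      using r by (simp only: powr_diff) simp
    \<comment> \<open>On \<open>[r, 2r]\<close> the weight x^(N-3) is at least r^(N-3) / 4, the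
      factor 4 coming from x \<le> 2r. This is how \<open>m\<close>, a power of r alone, can replace
      the variable weight.\<close>
    have "r ^ (N - 1) * x\<^sup>2 \<le> x ^ (N - 1) * (4 * r\<^sup>2)"
    proof (intro mult_mono)
      show "r ^ (N - 1) \<le> x ^ (N - 1)"
        using x r by (intro power_mono) auto
      have "x\<^sup>2 \<le> (2 * r)\<^sup>2"
        using x r by (intro power_mono) auto
      then show "x\<^sup>2 \<le> 4 * r\<^sup>2" by (simp add: power_mult_distrib)
    qed (use x r in auto)
    then have "r ^ (N - 1) * x\<^sup>2 * (U' x)\<^sup>2 \<le> x ^ (N - 1) * (4 * r\<^sup>2) * (U' x)\<^sup>2"
      by (rule mult_right_mono) simp
    then have "(U' x)\<^sup>2 \<le> 4 / s\<^sup>2 * m * q x"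
      using x r s unfolding m' q_def by (simp add: field_simps)
    then have "l * (U' x)\<^sup>2 \<le> l * (4 / s\<^sup>2 * m * q x)"
      using pos by (intro mult_left_mono) auto
    moreover have "2 * g x = l * (4 / s\<^sup>2 * m * q x) + 1 / l"
      by (simp add: g_def)
    ultimately have "l * (U' x)\<^sup>2 + 1 / l \<le> 2 * g x"
      by linarith
    moreover have "2 * \<bar>U' x\<bar> \<le> l * (U' x)\<^sup>2 + 1 / l"
    proof -
      have "0 \<le> (l * \<bar>U' x\<bar> - 1)\<^sup>2 / l"
        using pos by auto
      also have "\<dots> = l * (U' x)\<^sup>2 + 1 / l - 2 * \<bar>U' x\<bar>"
        using pos by (simp add: field_simps power2_eq_square)
      finally show ?thesis by simp
    qed
    ultimately show ?thesis by linarith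
  qed
  have "(U' has_integral (U t - U r)) {r..t}"
    using r by (intro fundamental_theorem_of_calculus)
      (auto simp: has_real_derivative_iff_has_vector_derivative[symmetric] intro!: has_field_derivative_at_within[OF dU])
  then have U'_int: "\<bar>U t - U r\<bar> = norm (integral {r..t} U')" "U' integrable_on {r..t}"
    by (auto simp: integral_unique)
  have g_int': "g integrable_on {r..t}"
    using r by (intro integrable_on_subinterval[OF g_int]) auto
  have "\<bar>U t - U r\<bar> \<le> integral {r..t} g"
    unfolding U'_int(1)
  proof (rule integral_norm_bound_integral[OF U'_int(2) g_int'])
    show "norm (U' x) \<le> g x" if "x \<in> {r..t}" for x
      using g_ge[of x] that r by simp
  qed
  also have "\<dots> \<le> integral {r..2*r} g"
  proof (rule integral_subset_le[OF _ g_int' g_int])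
    show "\<forall>x\<in>{r..2*r}. 0 \<le> g x"
      using g_ge abs_ge_zero order_trans by blast
  qed (use r in auto)
  also have "\<dots> = (l * (4 / s\<^sup>2 * m * integral {r..2*r} q) + r / l) / 2"
  proof (rule integral_unique)
    have "((\<lambda>x. 1 / l) has_integral r / l) {r..2*r}"
      using has_integral_const_real[of "1 / l" r "2 * r"] r by simp
    then show "(g has_integral (l * (4 / s\<^sup>2 * m * integral {r..2*r} q) + r / l) / 2) {r..2*r}"
      unfolding g_def using integrable_integral[OF q_int]
      by (intro has_integral_divide[OF has_integral_add] has_integral_mult_right)
  qed
  also have "\<dots> \<le> (l * (4 / s\<^sup>2 * m * (C * r powr (-2 * s))) + r / l) / 2"
  proof -
    have "set_integrable lebesgue {r..2*r} q"
      by (rule absolutely_integrable_continuous_real[OF q_cont])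
    then have "r powr (2 * s) * integral {r..2*r} q \<le> C"
      using decay by (simp add: set_lebesgue_integral_eq_integral(2)[symmetric] q_def)
    then have "integral {r..2*r} q \<le> C * r powr (-2 * s)"
      using r by (simp add: powr_minus field_simps)
    then show ?thesis
      using pos by (intro divide_right_mono add_right_mono mult_left_mono) auto
  qed
  also have "\<dots> = (4 * C / s\<^sup>2 * (l * m * r powr (-2 * s)) + r powr 1 / l) / 2"
    using r by (simp add: field_simps)
  also have "l * m * r powr (-2 * s) = r powr (2 - real N / 2 - s)"
    unfolding l_def m_def powr_add[symmetric] by (rule arg_cong[of _ _ "(powr) r"]) (simp add: field_simps)
  also have "r powr 1 / l = r powr (2 - real N / 2 - s)"
    unfolding l_def powr_diff[symmetric] by (rule arg_cong[of _ _ "(powr) r"]) (simp add: field_simps)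
  also have "(4 * C / s\<^sup>2 * r powr (2 - real N / 2 - s) + r powr (2 - real N / 2 - s)) / 2
      = (4 * C / s\<^sup>2 + 1) / 2 * r powr (2 - real N / 2 - s)"
    by (simp add: algebra_simps add_divide_distrib)
  finally show ?thesis .
qed

text \<open>Near the zero \<open>a\<close> the Lipschitz function \<open>U'\<close> is O(\<epsilon>)
  on \<open>[a, a + \<epsilon>]\<close>, so the weight integrates to O(\<epsilon>^3) over the ramp.
  The squared slope costs only \<epsilon>^(-2), and the bound from energy decay tends to 0 with
  \<epsilon>.\<close>

lemma critical_point_imp_eventually_constant:
  fixes U' :: "real \<Rightarrow> real" and N :: nat
  assumes stable: "weighted_stable_HS_power (\<lambda>r. r ^ (N - 1) * (U' r)\<^sup>2) s"
    and dU': "\<And>x. 1 < x \<Longrightarrow> (U' has_real_derivative U'' x) (at x)" and cont: "continuous_on {1<..} U''"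
    and s: "0 < s" and a: "1 < a" "U' a = 0" and r: "a + 1 < r"
  shows "U' r = 0"
proof -
  interpret weighted_stable_HS_power "\<lambda>r. r ^ (N - 1) * (U' r)\<^sup>2" s by fact
  let ?w = "\<lambda>r. r ^ (N - 1) * (U' r)\<^sup>2"
  obtain L where L: "L-lipschitz_on {a..a+1} U'"
    by (rule lipschitz_on_Icc_C1[of a "a + 1" U' U'']) (use a dU' cont in \<open>auto elim: continuous_on_subset\<close>)
  define A where "A = (a + 1) ^ (N - 1) * L\<^sup>2"
  have w_le: "?w x \<le> A * \<epsilon>\<^sup>2" if "x \<in> {a..a+\<epsilon>}" "0 < \<epsilon>" "\<epsilon> \<le> 1" for x \<epsilon>
  proof -
    have "\<bar>U' x\<bar> \<le> L * \<bar>x - a\<bar>"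
      using lipschitz_onD[OF L, of x a] that a by (simp add: dist_real_def)
    also have "\<dots> \<le> L * \<epsilon>"
      using that lipschitz_on_nonneg[OF L] by (intro mult_left_mono) auto
    finally have "\<bar>U' x\<bar>\<^sup>2 \<le> (L * \<epsilon>)\<^sup>2"
      by (rule power_mono) simp
    then have "?w x \<le> (a + 1) ^ (N - 1) * (L * \<epsilon>)\<^sup>2"
      using that a by (intro mult_mono[OF power_mono]) auto
    then show ?thesis
      by (simp add: A_def power_mult_distrib mult_ac)
  qed
  define B where "B = ((1 + s) * (a + 1) powr s)\<^sup>2"
  let ?q = "\<lambda>x. ?w x * (s\<^sup>2 / x\<^sup>2)"
  define I where "I = (a + 1) powr (2 * s) * (LINT x:{a+1..r}|lebesgue. ?q x)"
  have small: "I \<le> B * A * \<epsilon>" if \<epsilon>: "0 < \<epsilon>" "\<epsilon> \<le> 1" for \<epsilon>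
  proof -
    have w_cont': "continuous_on {a..a+\<epsilon>} ?w"
      using w_cont by (rule continuous_on_subset) (use a in auto)
    have "(LINT x:{a..a+\<epsilon>}|lebesgue. ?w x) \<le> (LINT x:{a..a+\<epsilon>}|lebesgue. A * \<epsilon>\<^sup>2)"
      by (intro set_integral_mono set_integrable_lebesgue_continuous w_cont' continuous_intros w_le \<epsilon>)
    also have "\<dots> = A * \<epsilon>\<^sup>2 * \<epsilon>"
      using \<epsilon> by (simp add: set_lebesgue_integral_def)
    finally have "(LINT x:{a..a+\<epsilon>}|lebesgue. ?w x) \<le> A * \<epsilon>\<^sup>2 * \<epsilon>" .
    then have "((1 + s) * (a + 1) powr s / \<epsilon>)\<^sup>2 * (LINT x:{a..a+\<epsilon>}|lebesgue. ?w x)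
        \<le> ((1 + s) * (a + 1) powr s / \<epsilon>)\<^sup>2 * (A * \<epsilon>\<^sup>2 * \<epsilon>)"
      by (rule mult_left_mono) simp
    also have "\<dots> = B * A * \<epsilon>"
      using \<epsilon> by (simp add: B_def power_divide)
    finally show ?thesis
      using energy_decay[OF a(1) \<epsilon> order_refl r] unfolding I_def by linarith
  qed
  have "I \<le> 0"
  proof (rule tendsto_lowerbound)
    show "((\<lambda>\<epsilon>. B * A * \<epsilon>) \<longlongrightarrow> 0) (at_right 0)"
      by (auto intro!: tendsto_eq_intros)
    show "\<forall>\<^sub>F \<epsilon> in at_right 0. I \<le> B * A * \<epsilon>"
      using eventually_at_right_real[of 0 1] by (auto elim!: eventually_mono intro: small)
  qed simp
  then have "(LINT x:{a+1..r}|lebesgue. ?q x) \<le> 0"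
    using a by (simp add: I_def mult_le_0_iff)
  moreover have q_cont: "continuous_on {a+1..r} ?q"
    using a by (intro continuous_intros continuous_on_subset[OF w_cont]) auto
  ultimately have "integral {a+1..r} ?q \<le> 0"
    using set_lebesgue_integral_eq_integral(2)[OF set_integrable_lebesgue_continuous[OF q_cont]] by simp
  moreover have "0 \<le> integral {a+1..r} ?q"
    using a by (intro integral_nonneg integrable_continuous_real q_cont) auto
  ultimately have "integral {a+1..r} ?q = 0" by simp
  \<comment> \<open>A nonnegative continuous function with zero integral vanishes on the whole
    closed interval, in particular at its right endpoint.\<close>
  then have "?q r = 0"
    using integral_eq_0_iff[OF q_cont r] a r by auto
  then show ?thesis
    using a r s by auto
qed

lemma profile_asymptotics:
  fixes U U' :: "real \<Rightarrow> real" and N :: nat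
  assumes stable: "weighted_stable_HS_power (\<lambda>r. r ^ (N - 1) * (U' r)\<^sup>2) s"
    and N: "N \<ge> 2" and s: "s = sqrt (real N - 1)" and U_cont: "continuous_on {1..} U"
    and dU: "\<And>x. 1 < x \<Longrightarrow> (U has_real_derivative U' x) (at x)"
    and dU': "\<And>x. 1 < x \<Longrightarrow> (U' has_real_derivative U'' x) (at x)" and U''_cont: "continuous_on {1<..} U''"
  shows "\<exists>u_inf :: ereal. ((\<lambda>r. ereal (U r)) \<longlongrightarrow> u_inf) at_top \<and>
    (\<exists>M>0.
      (N = 2 \<longrightarrow> (\<forall>r\<ge>2. \<bar>U r\<bar> \<le> M * ln r)) \<and>
      (N \<ge> 3 \<longrightarrow> (\<exists>c. u_inf = ereal c \<and>
        (\<forall>r\<ge>1. \<bar>U r - c\<bar> \<le> M * r powr (- real N / 2 - s + 2)))))"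
proof -
  interpret weighted_stable_HS_power "\<lambda>r. r ^ (N - 1) * (U' r)\<^sup>2" s by fact
  have s1: "1 \<le> s" using N by (simp add: s)
  have U'_cont: "continuous_on {1<..} U'"
    using dU' by (auto simp: continuous_on_eq_continuous_at intro: DERIV_isCont)
  obtain l where l: "((\<lambda>r. ereal (U r)) \<longlongrightarrow> l) at_top"
  proof -
    have "\<exists>l. ((\<lambda>r. ereal (U r)) \<longlongrightarrow> l) at_top"
    proof (rule ereal_limit_at_top_if_deriv_sign[OF dU U'_cont])
      fix a :: real assume a: "1 < a" "U' a = 0"
      then show "\<exists>c>1. \<forall>r\<ge>c. U' r = 0"
        using critical_point_imp_eventually_constant[OF stable dU' U''_cont _ a] s1
        by (intro exI[of _ "a + 2"]) auto
    qed
    then show ?thesis using that by blast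
  qed
  define \<beta> where "\<beta> = 2 - real N / 2 - s"
  \<comment> \<open>The ramp is fixed on \<open>[2, 3]\<close>, that is, energy decay is used with a
    = 2 and \<epsilon> = 1. This gives one constant for all r \<ge> 3.\<close>
  define C where "C = ((1 + s) * (2 + 1) powr s / 1)\<^sup>2 * (LINT r:{2..2+1}|lebesgue. r ^ (N - 1) * (U' r)\<^sup>2)"
  define K where "K = (4 * C / s\<^sup>2 + 1) / 2"
  have step: "\<bar>U t - U r\<bar> \<le> K * r powr \<beta>" if r: "3 \<le> r" "r \<le> t" "t \<le> 2 * r" for r t
    unfolding K_def \<beta>_def
  proof (rule increment_le_weighted_energy[OF dU U'_cont])
    show "r powr (2 * s) * (LINT x:{r..2*r}|lebesgue. x ^ (N - 1) * (U' x)\<^sup>2 * (s\<^sup>2 / x\<^sup>2)) \<le> C"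
      unfolding C_def by (rule energy_decay) (use r in auto)
  qed (use N s1 r in auto)
  have "bounded (U ` {1..3})"
    by (intro compact_imp_bounded compact_continuous_image continuous_on_subset[OF U_cont]) auto
  then obtain B where B: "\<And>r. 1 \<le> r \<Longrightarrow> r \<le> 3 \<Longrightarrow> \<bar>U r\<bar> \<le> B"
    unfolding bounded_iff by fastforce
  have "0 \<le> B" using B[of 1] by simp
  have "0 \<le> K" using step[of 3 3] by (auto simp: zero_le_mult_iff)
  consider "N = 2" | "N \<ge> 3" using N by linarith
  then show ?thesis
  proof cases
    case 1
    then have "\<beta> = 0" by (simp add: \<beta>_def s)
    \<comment> \<open>The summand \<open>B / ln 2\<close> serves r \<le> 3, where ln r \<ge> ln 2.
      For r > 3 > e the constants \<open>B + K\<close> are absorbed by ln r \<ge> 1, and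
      \<open>K / ln 2\<close> comes from the count of doublings. The summand 1 makes
      \<open>M\<close> positive.\<close>
    define M where "M = B + K + K / ln 2 + B / ln 2 + 1"
    have "\<bar>U r\<bar> \<le> M * ln r" if "2 \<le> r" for r
    proof (cases "r \<le> 3")
      case True
      have "\<bar>U r\<bar> \<le> B / ln 2 * ln 2"
        using B[of r] that True by simp
      also have "\<dots> \<le> M * ln r"
        using that \<open>0 \<le> B\<close> \<open>0 \<le> K\<close> by (intro mult_mono) (auto simp: M_def)
      finally show ?thesis .
    next
      case False
      have "exp 1 \<le> r"
        using False e_less_272 by linarith
      then have ln1: "1 \<le> ln r"
        using that by (subst ln_ge_iff) auto
      have "\<bar>U r - U 3\<bar> \<le> K * (ln r / ln 2 + 1)"
        by (rule dyadic_count_bound) (use step \<open>\<beta> = 0\<close> False in auto)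
      then have "\<bar>U r\<bar> \<le> (B + K) * 1 + K / ln 2 * ln r"
        using B[of 3] by (simp add: algebra_simps)
      also have "\<dots> \<le> (B + K) * ln r + K / ln 2 * ln r"
        using ln1 \<open>0 \<le> B\<close> \<open>0 \<le> K\<close> by (intro add_mono mult_left_mono) auto
      also have "\<dots> \<le> M * ln r"
        unfolding distrib_right[symmetric] using ln1 \<open>0 \<le> B\<close> by (intro mult_right_mono) (auto simp: M_def)
      finally show ?thesis .
    qed
    moreover have "0 < M"
      using \<open>0 \<le> B\<close> \<open>0 \<le> K\<close> by (auto simp: M_def intro!: add_nonneg_pos add_nonneg_nonneg)
    ultimately show ?thesis
      using l 1 by auto
  next
    case 2
    have "\<beta> < 0"
    proof -
      \<comment> \<open>Here s is at least the square root of 2. Any lower bound above 1/2 would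
        make the exponent negative, since N / 2 \<ge> 3/2.\<close>
      have "1.4 \<le> s"
        unfolding s using 2 by (intro real_le_rsqrt) (auto simp: power2_eq_square)
      then show ?thesis using 2 by (simp add: \<beta>_def)
    qed
    define K' where "K' = K / (1 - 2 powr \<beta>)"
    have "0 \<le> K'"
      using \<open>0 \<le> K\<close> \<open>\<beta> < 0\<close> by (auto simp: K'_def powr_less_one less_imp_le)
    have tail: "\<bar>U t - U r\<bar> \<le> K' * r powr \<beta>" if "3 \<le> r" "r \<le> t" for r t
      unfolding K'_def by (rule dyadic_sum_bound[OF step \<open>\<beta> < 0\<close> _ that]) auto
    have ev: "\<forall>\<^sub>F t in at_top. \<bar>U t - U r\<bar> \<le> K' * r powr \<beta>" if "3 \<le> r" for r
      using eventually_ge_at_top[of r] by eventually_elim (rule tail[OF that])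
    have "\<bar>l\<bar> \<noteq> \<infinity>"
    proof -
      have "l \<le> ereal (U 3 + K' * 3 powr \<beta>)"
        by (rule tendsto_upperbound[OF l]) (use ev[of 3] in \<open>auto elim!: eventually_mono\<close>)
      moreover have "ereal (U 3 - K' * 3 powr \<beta>) \<le> l"
        by (rule tendsto_lowerbound[OF l]) (use ev[of 3] in \<open>auto elim!: eventually_mono\<close>)
      ultimately show ?thesis by auto
    qed
    then obtain c where c: "l = ereal c" by (cases l) auto
    with l have lim: "(U \<longlongrightarrow> c) at_top" by simp
    have far: "\<bar>U r - c\<bar> \<le> K' * r powr \<beta>" if "3 \<le> r" for r
    proof -
      have "((\<lambda>t. \<bar>U t - U r\<bar>) \<longlongrightarrow> \<bar>c - U r\<bar>) at_top"
        by (intro tendsto_intros lim)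
      then have "\<bar>c - U r\<bar> \<le> K' * r powr \<beta>"
        by (rule tendsto_upperbound) (use ev[OF that] in auto)
      then show ?thesis by (simp add: abs_minus_commute)
    qed
    \<comment> \<open>\<open>K'\<close> serves r \<ge> 3. The quotient serves 1 \<le> r < 3, where
      the decreasing power r^\<beta> is at least 3^\<beta>.\<close>
    define M where "M = K' + (B + \<bar>c\<bar>) / 3 powr \<beta> + 1"
    have M1: "K' \<le> M" "(B + \<bar>c\<bar>) / 3 powr \<beta> \<le> M" "0 < M"
      using \<open>0 \<le> K'\<close> \<open>0 \<le> B\<close> by (auto simp: M_def intro!: add_nonneg_pos add_nonneg_nonneg)
    have "\<bar>U r - c\<bar> \<le> M * r powr \<beta>" if "1 \<le> r" for r
    proof (cases "3 \<le> r")
      case True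
      have "K' * r powr \<beta> \<le> M * r powr \<beta>"
        using M1 by (intro mult_right_mono) auto
      with far[OF True] show ?thesis by linarith
    next
      case False
      have "\<bar>U r - c\<bar> \<le> (B + \<bar>c\<bar>) / 3 powr \<beta> * 3 powr \<beta>"
        using B[of r] that False by simp
      also have "\<dots> \<le> M * r powr \<beta>"
        using M1 that False \<open>\<beta> < 0\<close> by (intro mult_mono powr_mono2') auto
      finally show ?thesis .
    qed
    moreover have "- real N / 2 - s + 2 = \<beta>"
      by (simp add: \<beta>_def)
    ultimately show ?thesis
      using l c M1 2 by auto
  qed
qed

section \<open>Radial functions\<close>

text \<open>Polar coordinates for radial functions: the volume of the ball of radius x is the
  distribution function of the norm, and its derivative is the density. Half-lines are stable under
  intersection and generate the Borel sets, so agreement on them is enough.\<close>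

lemma distr_norm_lborel:
  "distr (lborel :: 'a::euclidean_space measure) borel norm =
   density lborel (\<lambda>r. ennreal (real DIM('a) * unit_ball_vol (real DIM('a)) * r ^ (DIM('a) - 1)) * indicator {0..} r)"
    (is "?M = density lborel ?f")
proof (rule measure_eqI_generator_eq[where E = "range atMost" and \<Omega> = UNIV and A = "\<lambda>i. {..real i}"])
  let ?c = "unit_ball_vol (real DIM('a))"
  have emeasure_M: "emeasure ?M {..x} = (if 0 \<le> x then ennreal (?c * x ^ DIM('a)) else 0)" for x
  proof -
    have "emeasure ?M {..x} = emeasure (lborel :: 'a measure) (norm -` {..x} \<inter> space lborel)"
      by (rule emeasure_distr) auto
    also have "norm -` {..x} \<inter> space lborel = (cball 0 x :: 'a set)"
      by (auto simp: cball_def dist_norm)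
    finally show ?thesis
      by (auto simp: emeasure_cball not_le cball_empty)
  qed
  show "emeasure ?M X = emeasure (density lborel ?f) X" if X': "X \<in> range atMost" for X
  proof -
    obtain x where X: "X = {..x}" using X' by blast
    have "emeasure (density lborel ?f) {..x} = (\<integral>\<^sup>+r. ?f r * indicator {..x} r \<partial>lborel)"
      by (subst emeasure_density) auto
    also have "\<dots> = (\<integral>\<^sup>+r. ennreal (real DIM('a) * ?c * r ^ (DIM('a) - 1)) * indicator {0..x} r \<partial>lborel)"
      by (intro nn_integral_cong) (auto simp: indicator_def)
    also have "\<dots> = (if 0 \<le> x then ennreal (?c * x ^ DIM('a)) else 0)"
    proof (cases "0 \<le> x")
      case True
      have "(\<integral>\<^sup>+r. ennreal (real DIM('a) * ?c * r ^ (DIM('a) - 1)) * indicator {0..x} r \<partial>lborel)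
          = ennreal (?c * x ^ DIM('a) - ?c * 0 ^ DIM('a))"
        by (rule nn_integral_FTC_Icc) (use True in \<open>auto intro!: derivative_eq_intros mult_nonneg_nonneg\<close>)
      then show ?thesis using True by (simp add: power_0_left)
    qed auto
    finally show ?thesis
      unfolding X emeasure_M by simp
  qed
  show "sets ?M = sigma_sets UNIV (range atMost)" "sets (density lborel ?f) = sigma_sets UNIV (range atMost)"
    by (simp_all add: borel_eq_atMost)
  show "Int_stable (range (atMost :: real \<Rightarrow> _))"
    by (auto simp: Int_stable_def)
  show "(\<Union>i. {..real i}) = UNIV"
    using real_arch_simple by auto
  show "emeasure ?M {..real i} \<noteq> \<infinity>" for i
    unfolding emeasure_M by auto
qed (simp, blast)

text \<open>No integrability is required: passing to the image measure and to the density preserves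
  the Bochner integral, including its default value 0.\<close>

lemma integral_radial:
  fixes g :: "real \<Rightarrow> real"
  assumes [measurable]: "g \<in> borel_measurable borel"
  shows "(LINT x::'a::euclidean_space|lebesgue. g (norm x)) =
    real DIM('a) * unit_ball_vol (real DIM('a)) * (LINT r:{0..}|lebesgue. r ^ (DIM('a) - 1) * g r)"
proof -
  let ?c = "real DIM('a) * unit_ball_vol (real DIM('a))"
  have "(LINT x::'a|lebesgue. g (norm x)) = (LINT x::'a|lborel. g (norm x))"
    by (rule integral_completion) simp
  also have "\<dots> = (LINT r|distr (lborel :: 'a measure) borel norm. g r)"
    by (rule integral_distr[symmetric]) auto
  also have "\<dots> = (LINT r|density lborel (\<lambda>r. ennreal (?c * r ^ (DIM('a) - 1) * indicator {0..} r)). g r)"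
    unfolding distr_norm_lborel
    by (intro arg_cong2[of _ _ _ _ "integral\<^sup>L"] arg_cong2[of _ _ _ _ density] ext) (auto simp: indicator_def)
  also have "\<dots> = (LINT r|lborel. (?c * r ^ (DIM('a) - 1) * indicator {0..} r) *\<^sub>R g r)"
    by (rule integral_density) (auto simp: indicator_def)
  also have "\<dots> = (LINT r|lborel. ?c * (indicator {0..} r *\<^sub>R (r ^ (DIM('a) - 1) * g r)))"
    by (intro Bochner_Integration.integral_cong) auto
  also have "\<dots> = ?c * (LINT r|lborel. indicator {0..} r *\<^sub>R (r ^ (DIM('a) - 1) * g r))"
    by simp
  also have "(LINT r|lborel. indicator {0..} r *\<^sub>R (r ^ (DIM('a) - 1) * g r)) = (LINT r:{0..}|lebesgue. r ^ (DIM('a) - 1) * g r)"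
    unfolding set_lebesgue_integral_def by (rule integral_completion[symmetric]) simp
  finally show ?thesis .
qed

lemma open_ext_open: "open (ext_open :: 'a::euclidean_space set)"
  unfolding ext_open_def by (intro open_Collect_less continuous_intros)

lemma at_within_ext:
  assumes "x \<in> (ext_open :: 'a::euclidean_space set)"
  shows "at x within ext_open = at x" "at x within ext_closed = at x"
proof -
  show "at x within ext_open = at x"
    using assms open_ext_open by (rule at_within_open)
  have "ext_open \<subseteq> (ext_closed :: 'a set)"
    by (auto simp: ext_open_def ext_closed_def)
  then have "x \<in> interior ext_closed"
    using assms open_ext_open by (intro interiorI)
  then show "at x within ext_closed = at x"
    by (rule at_within_interior)
qed

lemma has_derivative_radial:
  fixes x :: "'a::euclidean_space"
  assumes x: "x \<in> ext_open" and v: "\<And>y. y \<in> ext_open \<Longrightarrow> v y = \<phi> (norm y)"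
    and \<phi>: "(\<phi> has_real_derivative d) (at (norm x))"
  shows "(v has_derivative (\<lambda>h. d * (x \<bullet> h / norm x))) (at x)"
proof -
  have "x \<noteq> 0" using x by (auto simp: ext_open_def)
  have "((\<lambda>y. \<phi> (norm y)) has_derivative (\<lambda>h. d * (x \<bullet> h / norm x))) (at x)"
    by (rule has_derivative_compose[OF has_derivative_norm[OF \<open>x \<noteq> 0\<close>] \<phi>[unfolded has_field_derivative_def],
          THEN has_derivative_eq_rhs])
       (auto simp: sgn_div_norm inner_commute divide_inverse mult_ac)
  then show ?thesis
    by (rule has_derivative_transform_within_open[OF _ open_ext_open x]) (use v in auto)
qed

lemma grad_on_radial:
  fixes x :: "'a::euclidean_space"
  assumes x: "x \<in> ext_open" and S: "at x within S = at x" and v: "\<And>y. y \<in> ext_open \<Longrightarrow> v y = \<phi> (norm y)"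
    and \<phi>: "(\<phi> has_real_derivative d) (at (norm x))"
  shows "grad_on S v x = (d / norm x) *\<^sub>R x"
proof -
  have "frechet_derivative v (at x within S) = (\<lambda>h. d * (x \<bullet> h / norm x))"
    unfolding S using has_derivative_radial[OF x v \<phi>] by (rule frechet_derivative_at[symmetric])
  then have "grad_on S v x = (\<Sum>b\<in>Basis. (d / norm x) *\<^sub>R ((x \<bullet> b) *\<^sub>R b))"
    by (simp add: grad_on_def)
  also have "\<dots> = (d / norm x) *\<^sub>R x"
    by (simp only: scaleR_sum_right[symmetric] euclidean_representation)
  finally show ?thesis .
qed

text \<open>The gradient is \<psi>(|y|) y with \<psi>(r) = \<phi>'(r) / r. The trace of its
  derivative is n \<psi> + r \<psi>' in dimension n, which is the radial Laplacian.\<close>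

lemma laplacian_on_radial:
  fixes x :: "'a::euclidean_space"
  assumes x: "x \<in> ext_open" and v: "\<And>y. y \<in> ext_open \<Longrightarrow> v y = \<phi> (norm y)"
    and \<phi>: "\<And>r. 1 < r \<Longrightarrow> (\<phi> has_real_derivative \<phi>' r) (at r)"
    and \<phi>': "(\<phi>' has_real_derivative d2) (at (norm x))"
  shows "laplacian_on ext_closed v x = d2 + (real DIM('a) - 1) / norm x * \<phi>' (norm x)"
proof -
  define r where "r = norm x"
  have r: "1 < r" using x by (simp add: r_def ext_open_def)
  define \<psi>' where "\<psi>' = (d2 * r - \<phi>' r) / r\<^sup>2"
  have "((\<lambda>r. \<phi>' r / r) has_real_derivative \<psi>') (at (norm x))"
    using \<phi>' r unfolding r_def[symmetric] \<psi>'_def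
    by (auto intro!: derivative_eq_intros simp: power2_eq_square)
  then have \<psi>: "((\<lambda>y. \<phi>' (norm y) / norm y) has_derivative (\<lambda>h. \<psi>' * (x \<bullet> h / norm x))) (at x)"
    by (intro has_derivative_radial[OF x, where \<phi> = "\<lambda>r. \<phi>' r / r"]) auto
  have "((\<lambda>y. (\<phi>' (norm y) / norm y) *\<^sub>R y) has_derivative
      (\<lambda>h. (\<phi>' r / r) *\<^sub>R h + (\<psi>' * (x \<bullet> h / r)) *\<^sub>R x)) (at x)"
    using has_derivative_scaleR[OF \<psi> has_derivative_ident] by (simp add: r_def)
  then have "(grad_on ext_closed v has_derivative
      (\<lambda>h. (\<phi>' r / r) *\<^sub>R h + (\<psi>' * (x \<bullet> h / r)) *\<^sub>R x)) (at x)"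
  proof (rule has_derivative_transform_within_open[OF _ open_ext_open x])
    fix y :: 'a assume y: "y \<in> ext_open"
    then show "(\<phi>' (norm y) / norm y) *\<^sub>R y = grad_on ext_closed v y"
      by (intro grad_on_radial[symmetric, OF y at_within_ext(2)[OF y] v \<phi>]) (auto simp: ext_open_def)
  qed
  then have "frechet_derivative (grad_on ext_closed v) (at x within ext_closed) =
      (\<lambda>h. (\<phi>' r / r) *\<^sub>R h + (\<psi>' * (x \<bullet> h / r)) *\<^sub>R x)"
    unfolding at_within_ext(2)[OF x] by (rule frechet_derivative_at[symmetric])
  then have "laplacian_on ext_closed v x = (\<Sum>b\<in>Basis. \<phi>' r / r + \<psi>' / r * ((x \<bullet> b) * (x \<bullet> b)))"
    unfolding laplacian_on_def
    by (auto intro!: sum.cong simp: inner_add_left inner_same_Basis algebra_simps)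
  also have "\<dots> = real DIM('a) * (\<phi>' r / r) + \<psi>' / r * (\<Sum>b\<in>Basis. (x \<bullet> b) * (x \<bullet> b))"
    by (simp add: sum.distrib sum_distrib_left)
  also have "(\<Sum>b\<in>Basis. (x \<bullet> b) * (x \<bullet> b)) = r\<^sup>2"
    by (simp add: euclidean_inner[symmetric] r_def dot_square_norm)
  also have "real DIM('a) * (\<phi>' r / r) + \<psi>' / r * r\<^sup>2 = d2 + (real DIM('a) - 1) / r * \<phi>' r"
    using r by (simp add: \<psi>'_def field_simps power2_eq_square)
  finally show ?thesis by (simp add: r_def)
qed

text \<open>The profile is the restriction of \<open>u\<close> to the ray through a basis vector
  \<open>e\<close>, so its derivatives are directional derivatives of \<open>u\<close> along
  \<open>e\<close>.\<close>

lemma radial_profile_C2: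
  fixes u :: "'a::euclidean_space \<Rightarrow> real"
  assumes C2: "C2_on ext_closed u" and U: "radial_profile u U"
  obtains U'' where "continuous_on {1..} U"
    "\<And>r. 1 < r \<Longrightarrow> (U has_real_derivative radial_deriv U r) (at r)"
    "\<And>r. 1 < r \<Longrightarrow> (radial_deriv U has_real_derivative U'' r) (at r)"
    "continuous_on {1<..} U''"
proof -
  obtain u' where u': "C1_on ext_closed u'"
    "\<And>x. x \<in> ext_closed \<Longrightarrow> (u has_derivative blinfun_apply (u' x)) (at x within ext_closed)"
    using C2 unfolding C2_on_def by blast
  obtain u'' where u'': "continuous_on ext_closed u''"
    "\<And>x. x \<in> ext_closed \<Longrightarrow> (u' has_derivative blinfun_apply (u'' x)) (at x within ext_closed)"
    using u'(1) unfolding C1_on_def by blast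
  obtain e :: 'a where e: "e \<in> Basis" using nonempty_Basis by blast
  have norm_e: "norm (r *\<^sub>R e) = \<bar>r\<bar>" for r
    using e by simp
  have Ue: "U r = u (r *\<^sub>R e)" if "1 \<le> r" for r
    using U that norm_e[of r] unfolding radial_profile_def by (auto simp: ext_closed_def)
  have re: "r *\<^sub>R e \<in> ext_closed" "r *\<^sub>R e \<in> ext_open" if "1 < r" for r
    using that norm_e[of r] by (auto simp: ext_closed_def ext_open_def)
  have line: "((\<lambda>r. r *\<^sub>R e) has_derivative (\<lambda>h. h *\<^sub>R e)) (at r)" for r
    by (auto intro!: derivative_eq_intros)
  show ?thesis
  proof (rule that)
    have "continuous_on ext_closed u"
      using u'(2) by (rule has_derivative_continuous_on)
    then have "continuous_on {1..} (\<lambda>r. u (r *\<^sub>R e))"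
      by (rule continuous_on_compose2) (use e in \<open>auto intro!: continuous_intros simp: ext_closed_def\<close>)
    then show "continuous_on {1..} U"
      by (rule continuous_on_eq) (use Ue in auto)
  next
    have dU: "(U has_real_derivative u' (r *\<^sub>R e) e) (at r)" if r: "1 < r" for r
    proof -
      have "((\<lambda>r. u (r *\<^sub>R e)) has_derivative (\<lambda>h. u' (r *\<^sub>R e) (h *\<^sub>R e))) (at r)"
        using u'(2)[OF re(1)[OF r]] unfolding at_within_ext(2)[OF re(2)[OF r]]
        by (rule has_derivative_compose[OF line])
      then have "((\<lambda>r. u (r *\<^sub>R e)) has_real_derivative u' (r *\<^sub>R e) e) (at r)"
        by (simp add: has_field_derivative_def blinfun.scaleR_right mult_commute_abs)
      then show ?thesis
        by (rule has_field_derivative_transform_within_open[of _ _ _ "{1<..}"]) (use r Ue in auto)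
    qed
    have rd: "radial_deriv U r = u' (r *\<^sub>R e) e" if r: "1 < r" for r
    proof -
      have "at r within {1..} = at r"
        using r by (intro at_within_interior) (rule interiorI[of "{1<..}"], auto)
      then show ?thesis
        using dU[OF r] unfolding radial_deriv_def
        by (simp add: vector_derivative_at has_real_derivative_iff_has_vector_derivative)
    qed
    show "(U has_real_derivative radial_deriv U r) (at r)" if "1 < r" for r
      using dU[OF that] rd[OF that] by simp
    show "(radial_deriv U has_real_derivative u'' (r *\<^sub>R e) e e) (at r)" if r: "1 < r" for r
    proof -
      have "((\<lambda>r. u' (r *\<^sub>R e)) has_derivative (\<lambda>h. u'' (r *\<^sub>R e) (h *\<^sub>R e))) (at r)"
        using u''(2)[OF re(1)[OF r]] unfolding at_within_ext(2)[OF re(2)[OF r]]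
        by (rule has_derivative_compose[OF line])
      then have "((\<lambda>r. u' (r *\<^sub>R e) e) has_derivative (\<lambda>h. u'' (r *\<^sub>R e) (h *\<^sub>R e) e)) (at r)"
        by (rule bounded_linear.has_derivative[OF blinfun.bounded_linear_left])
      then have "((\<lambda>r. u' (r *\<^sub>R e) e) has_real_derivative u'' (r *\<^sub>R e) e e) (at r)"
        by (simp add: has_field_derivative_def blinfun.scaleR_right blinfun.scaleR_left mult_commute_abs)
      then show ?thesis
        by (rule has_field_derivative_transform_within_open[of _ _ _ "{1<..}"]) (use r rd in auto)
    qed
    have "continuous_on {1<..} (\<lambda>r. u'' (r *\<^sub>R e))"
      by (rule continuous_on_compose2[OF u''(1)]) (use re in \<open>auto intro!: continuous_intros\<close>)
    then show "continuous_on {1<..} (\<lambda>r. u'' (r *\<^sub>R e) e e)"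
      by (intro blinfun.continuous_on continuous_on_const)
  qed
qed

lemma test_function_radial:
  fixes \<phi> \<phi>' :: "real \<Rightarrow> real"
  assumes \<phi>: "\<And>r. 1 < r \<Longrightarrow> (\<phi> has_real_derivative \<phi>' r) (at r)" and cont: "continuous_on {1<..} \<phi>'"
    and supp: "\<And>r. r \<notin> {a..b} \<Longrightarrow> \<phi> r = 0" and a: "1 < a"
  shows "test_function (\<lambda>x::'a::euclidean_space. \<phi> (norm x))"
  unfolding test_function_def
proof (intro conjI)
  let ?v = "\<lambda>x::'a. \<phi> (norm x)"
  show "C1_on ext_open ?v"
    unfolding C1_on_def
  proof (intro exI conjI ballI)
    show "continuous_on ext_open (\<lambda>x::'a. (\<phi>' (norm x) / norm x) *\<^sub>R blinfun_inner_right x)"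
      by (intro continuous_intros continuous_on_compose2[OF cont]
          bounded_linear.continuous_on[OF bounded_linear_blinfun_inner_right]) (auto simp: ext_open_def)
    fix x :: 'a assume x: "x \<in> ext_open"
    have "(?v has_derivative (\<lambda>h. \<phi>' (norm x) * (x \<bullet> h / norm x))) (at x)"
      by (rule has_derivative_radial[OF x, where \<phi> = \<phi>]) (use \<phi> x in \<open>auto simp: ext_open_def\<close>)
    then show "(?v has_derivative blinfun_apply ((\<phi>' (norm x) / norm x) *\<^sub>R blinfun_inner_right x)) (at x within ext_open)"
      unfolding at_within_ext(1)[OF x] by (simp add: blinfun.scaleR_left[abs_def])
  qed
  let ?A = "{x::'a. a \<le> norm x \<and> norm x \<le> b}"
  have "closed ?A"
    by (intro closed_Collect_conj closed_Collect_le continuous_intros)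
  moreover have "support_on ext_open ?v \<subseteq> ?A"
    using supp by (auto simp: support_on_def)
  ultimately have cl: "closure (support_on ext_open ?v) \<subseteq> ?A"
    by (rule closure_minimal[rotated])
  then show "closure (support_on ext_open ?v) \<subseteq> ext_open"
    using a by (auto simp: ext_open_def)
  have "bounded ?A"
    by (auto simp: bounded_iff)
  with cl show "compact (closure (support_on ext_open ?v))"
    by (auto simp: compact_eq_bounded_closed intro: bounded_subset)
qed

text \<open>For a radial test function the gradient has norm |\<phi>'|, so the integrand depends on
  |x| only, and polar coordinates reduce stability to one dimension. The positive factor
  \<open>c\<close>, the area of the unit sphere, cancels.\<close>

lemma stable_solution_radial:
  fixes u :: "'a::euclidean_space \<Rightarrow> real"
  assumes st: "stable_solution f u" and U: "radial_profile u U" and U_cont: "continuous_on {1..} U"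
    and f': "continuous_on UNIV (deriv f)"
    and \<phi>: "\<And>r. 1 < r \<Longrightarrow> (\<phi> has_real_derivative \<phi>' r) (at r)" and cont: "continuous_on {1<..} \<phi>'"
    and supp: "\<And>r. r \<notin> {a..b} \<Longrightarrow> \<phi> r = 0" and a: "1 < a"
  shows "0 \<le> (LINT r:{a..b}|lebesgue. r ^ (DIM('a) - 1) * ((\<phi>' r)\<^sup>2 - deriv f (U r) * (\<phi> r)\<^sup>2))"
proof -
  let ?v = "\<lambda>x::'a. \<phi> (norm x)"
  define G where "G r = (\<phi>' r)\<^sup>2 - deriv f (U r) * (\<phi> r)\<^sup>2" for r
  let ?G = "\<lambda>r. indicator {a..b} r *\<^sub>R G r"
  define c where "c = real DIM('a) * unit_ball_vol (real DIM('a))"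
  have "0 < c"
    by (simp add: c_def)
  have \<phi>_cont: "continuous_on {1<..} \<phi>"
    using \<phi> by (auto simp: continuous_on_eq_continuous_at intro: DERIV_isCont)
  have "continuous_on {1<..} G"
    unfolding G_def
    by (intro continuous_intros cont \<phi>_cont continuous_on_compose2[OF f' continuous_on_subset[OF U_cont]]) auto
  then have G_cont: "continuous_on {a..b} G"
    by (rule continuous_on_subset) (use a in auto)
  have G_meas: "?G \<in> borel_measurable borel"
    by (rule borel_measurable_continuous_on_indicator[OF _ G_cont]) simp
  \<comment> \<open>Off \<open>[a, b]\<close> the function \<phi> is locally zero. Hence the
    integrand vanishes there and may be multiplied by the indicator, which also makes it Borel
    measurable on the whole line.\<close>
  have \<phi>'_supp: "\<phi>' r = 0" if "1 < r" "r \<notin> {a..b}" for r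
  proof -
    have "open (- {a..b})" by auto
    have "((\<lambda>_. 0) has_real_derivative \<phi>' r) (at r)"
      by (rule has_field_derivative_transform_within_open[OF \<phi>[OF that(1)] \<open>open (- {a..b})\<close>])
         (use that supp in auto)
    then show ?thesis
      using DERIV_unique DERIV_const by blast
  qed
  have eq: "indicator ext_open x *\<^sub>R ((norm (grad_on ext_open ?v x))\<^sup>2 - deriv f (u x) * (?v x)\<^sup>2) = ?G (norm x)" for x
  proof (cases "x \<in> ext_open")
    case True
    then have x: "1 < norm x" by (simp add: ext_open_def)
    have "grad_on ext_open ?v x = (\<phi>' (norm x) / norm x) *\<^sub>R x"
      by (rule grad_on_radial[OF True at_within_ext(1)[OF True] refl]) (rule \<phi>[OF x])
    moreover have "u x = U (norm x)"
      using U x by (auto simp: radial_profile_def ext_closed_def)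
    ultimately have "(norm (grad_on ext_open ?v x))\<^sup>2 - deriv f (u x) * (?v x)\<^sup>2 = G (norm x)"
      using x by (auto simp: G_def power_mult_distrib power_divide)
    moreover have "G (norm x) = 0" if "norm x \<notin> {a..b}"
      using \<phi>'_supp[OF x that] supp[OF that] by (simp add: G_def)
    ultimately show ?thesis
      using True by (cases "norm x \<in> {a..b}") simp_all
  next
    case False
    then show ?thesis using a by (auto simp: ext_open_def indicator_def)
  qed
  have "0 \<le> (LINT x:ext_open|lebesgue. (norm (grad_on ext_open ?v x))\<^sup>2 - deriv f (u x) * (?v x)\<^sup>2)"
    using st test_function_radial[OF \<phi> cont supp a] unfolding stable_solution_def by blast
  also have "\<dots> = (LINT x::'a|lebesgue. ?G (norm x))"
    unfolding set_lebesgue_integral_def eq ..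
  also have "\<dots> = real DIM('a) * unit_ball_vol (real DIM('a)) * (LINT r:{0..}|lebesgue. r ^ (DIM('a) - 1) * ?G r)"
    by (rule integral_radial[OF G_meas])
  also have "(LINT r:{0..}|lebesgue. r ^ (DIM('a) - 1) * ?G r) = (LINT r:{a..b}|lebesgue. r ^ (DIM('a) - 1) * G r)"
    unfolding set_lebesgue_integral_def
  proof (rule Bochner_Integration.integral_cong[OF refl])
    fix r :: real
    show "indicator {0..} r *\<^sub>R (r ^ (DIM('a) - 1) * ?G r) = indicator {a..b} r *\<^sub>R (r ^ (DIM('a) - 1) * G r)"
      using a by (cases "r \<in> {a..b}") simp_all
  qed
  finally have "0 \<le> c * (LINT r:{a..b}|lebesgue. r ^ (DIM('a) - 1) * G r)"
    unfolding c_def .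
  then have "0 \<le> (LINT r:{a..b}|lebesgue. r ^ (DIM('a) - 1) * G r)"
    using \<open>0 < c\<close> by (simp add: zero_le_mult_iff)
  then show ?thesis by (simp add: G_def)
qed

section \<open>The one-dimensional stability inequality\<close>

text \<open>By the equation differentiated in r, \<open>u_r\<close> solves the linearised equation
  up to the extra term (N-1)/r^2 u_r. For test functions \<open>u_r \<eta>\<close> the terms
  containing f'(u) therefore cancel, and this extra term becomes the potential.\<close>

lemma weighted_stable_radial_deriv:
  fixes u :: "'a::euclidean_space \<Rightarrow> real" and U :: "real \<Rightarrow> real"
  defines "N \<equiv> DIM('a)"
  assumes f: "f C1_differentiable_on UNIV" and sol: "classical_solution f u"
    and st: "stable_solution f u" and U: "radial_profile u U"
  shows "weighted_stable (\<lambda>r. r ^ (N - 1) * (radial_deriv U r)\<^sup>2) (\<lambda>r. (real N - 1) / r\<^sup>2)"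
proof -
  let ?U1 = "radial_deriv U"
  have "C2_on ext_closed u"
    using sol by (simp add: classical_solution_def)
  then obtain U2 where U_cont: "continuous_on {1..} U"
    and dU: "\<And>r. 1 < r \<Longrightarrow> (U has_real_derivative ?U1 r) (at r)"
    and dU1: "\<And>r. 1 < r \<Longrightarrow> (?U1 has_real_derivative U2 r) (at r)"
    and U2_cont: "continuous_on {1<..} U2"
    by (rule radial_profile_C2[OF _ U]) blast
  have U1_cont: "continuous_on {1<..} ?U1"
    using dU1 by (auto simp: continuous_on_eq_continuous_at intro: DERIV_isCont)
  obtain f1 where f1: "\<And>x. (f has_real_derivative f1 x) (at x)" "continuous_on UNIV f1"
    using f unfolding C1_differentiable_on_def has_real_derivative_iff_has_vector_derivative by auto
  then have deriv_f: "deriv f = f1"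
    by (auto intro: DERIV_imp_deriv)
  have ode: "U2 r = - f (U r) - (real N - 1) / r * ?U1 r" if r: "1 < r" for r
  proof -
    obtain e :: 'a where e: "e \<in> Basis" using nonempty_Basis by blast
    define x where "x = r *\<^sub>R e"
    have nx: "norm x = r" using e r by (simp add: x_def)
    then have x: "x \<in> ext_open" "x \<in> ext_closed"
      using r by (auto simp: ext_open_def ext_closed_def)
    have "laplacian_on ext_closed u x = U2 r + (real DIM('a) - 1) / norm x * ?U1 (norm x)"
      by (rule laplacian_on_radial[OF x(1) _ dU]) (use U dU1[OF r] nx in \<open>auto simp: radial_profile_def ext_open_def ext_closed_def\<close>)
    moreover have "- laplacian_on ext_closed u x = f (u x)"
      using sol x by (auto simp: classical_solution_def)
    moreover have "u x = U r"
      using U x nx by (auto simp: radial_profile_def)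
    ultimately show ?thesis
      using nx by (simp add: N_def)
  qed
  \<comment> \<open>Although \<open>u\<close> is only C^2, its third radial derivative exists: the
    equation expresses \<open>U2\<close> through f(U) and \<open>U1\<close>, both
    differentiable.\<close>
  have dU2: "(U2 has_real_derivative - f1 (U r) * ?U1 r - (real N - 1) * (U2 r / r - ?U1 r / r\<^sup>2)) (at r)"
    if r: "1 < r" for r
  proof -
    have fU: "((\<lambda>r. f (U r)) has_real_derivative f1 (U r) * ?U1 r) (at r)"
      by (rule DERIV_chain2[OF f1(1) dU[OF r]])
    have "((\<lambda>r. - f (U r) - (real N - 1) / r * ?U1 r) has_real_derivative
        - f1 (U r) * ?U1 r - (real N - 1) * (U2 r / r - ?U1 r / r\<^sup>2)) (at r)"
      by (rule derivative_eq_intros fU dU1 r refl | use r in \<open>simp add: field_simps power2_eq_square\<close>)+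
    then show ?thesis
      by (rule has_field_derivative_transform_within_open[of _ _ _ "{1<..}"]) (use r ode in auto)
  qed
  show ?thesis
  proof
    show "continuous_on {1<..} (\<lambda>r. r ^ (N - 1) * (?U1 r)\<^sup>2)"
      by (intro continuous_intros U1_cont)
    show "continuous_on {1<..} (\<lambda>r. (real N - 1) / r\<^sup>2)"
      by (intro continuous_intros) auto
    show "0 \<le> r ^ (N - 1) * (?U1 r)\<^sup>2" if "1 < r" for r
      using that by auto
    fix a b :: real and \<eta> \<eta>' :: "real \<Rightarrow> real"
    assume ab: "1 < a" "a < b" and \<eta>: "\<And>r. (\<eta> has_real_derivative \<eta>' r) (at r)"
      and \<eta>': "continuous_on UNIV \<eta>'" and supp: "\<And>r. r \<notin> {a..b} \<Longrightarrow> \<eta> r = 0"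
    have \<eta>_cont: "continuous_on UNIV \<eta>"
      using DERIV_isCont[OF \<eta>] by (simp add: continuous_on_eq_continuous_at)
    \<comment> \<open>By continuity \<eta> vanishes also at the endpoints \<open>a\<close> and
      \<open>b\<close>, which removes the boundary terms of the integration by parts below.\<close>
    have "closed {r. \<eta> r = 0}"
      by (intro closed_Collect_eq \<eta>_cont continuous_on_const)
    moreover have "{..<a} \<subseteq> {r. \<eta> r = 0}" "{b<..} \<subseteq> {r. \<eta> r = 0}"
      using supp by auto
    ultimately have "closure {..<a} \<subseteq> {r. \<eta> r = 0}" "closure {b<..} \<subseteq> {r. \<eta> r = 0}"
      by (simp_all only: closure_minimal)
    then have ends: "\<eta> a = 0" "\<eta> b = 0"
      by auto
    define \<phi> where "\<phi> r = ?U1 r * \<eta> r" for r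
    define \<phi>' where "\<phi>' r = U2 r * \<eta> r + ?U1 r * \<eta>' r" for r
    define D where "D r = r ^ (N - 1) * ((\<phi>' r)\<^sup>2 - deriv f (U r) * (\<phi> r)\<^sup>2)" for r
    define E where "E r = r ^ (N - 1) * (?U1 r)\<^sup>2 * ((\<eta>' r)\<^sup>2 - (real N - 1) / r\<^sup>2 * (\<eta> r)\<^sup>2)" for r
    \<comment> \<open>\<open>D - E\<close> is the derivative of \<open>P\<close>, which vanishes at both ends.\<close>
    define P where "P r = r ^ (N - 1) * (U2 r * ?U1 r * (\<eta> r)\<^sup>2)" for r
    have "continuous_on {1<..} U"
      by (rule continuous_on_subset[OF U_cont]) auto
    then have conts: "continuous_on {1<..} \<eta>" "continuous_on {1<..} \<eta>'" "continuous_on {1<..} (\<lambda>r. f1 (U r))"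
      using \<eta>_cont \<eta>' by (auto intro: continuous_on_subset continuous_on_compose2[OF f1(2)])
    have \<phi>'_cont: "continuous_on {1<..} \<phi>'"
      unfolding \<phi>'_def by (intro continuous_intros U1_cont U2_cont conts)
    have "0 \<le> (LINT r:{a..b}|lebesgue. D r)"
      unfolding D_def N_def
    proof (rule stable_solution_radial[OF st U U_cont _ _ \<phi>'_cont _ ab(1)])
      show "(\<phi> has_real_derivative \<phi>' r) (at r)" if "1 < r" for r
        unfolding \<phi>_def \<phi>'_def using DERIV_mult[OF dU1[OF that] \<eta>[of r]] by (simp add: algebra_simps)
    qed (use deriv_f f1 supp in \<open>auto simp: \<phi>_def\<close>)
    moreover have "(LINT r:{a..b}|lebesgue. D r) = (LINT r:{a..b}|lebesgue. E r)"
    proof -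
      have D_cont: "continuous_on {a..b} D" and E_cont: "continuous_on {a..b} E"
      proof -
        have "continuous_on {1<..} D" "continuous_on {1<..} E"
          unfolding D_def E_def \<phi>_def deriv_f
          by (intro continuous_intros U1_cont conts \<phi>'_cont; simp)+
        then show "continuous_on {a..b} D" "continuous_on {a..b} E"
          using ab by (auto elim: continuous_on_subset)
      qed
      have P_deriv: "(P has_real_derivative D r - E r) (at r)" if "r \<in> {a..b}" for r
      proof -
        have r: "1 < r" using that ab by auto
        have pw: "((\<lambda>r. r ^ (N - 1)) has_real_derivative (real N - 1) * r ^ (N - 1) / r) (at r)"
        proof -
          have "1 \<le> N" by (simp add: N_def Suc_leI)
          then have "real (N - 1) * r ^ (N - 1 - Suc 0) = (real N - 1) * r ^ (N - 1) / r"
            using r by (cases "N - 1") (auto simp: of_nat_diff)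
          then show ?thesis
            using DERIV_pow[of "N - 1" r UNIV] by simp
        qed
        have "((\<lambda>r. U2 r * ?U1 r * (\<eta> r)\<^sup>2) has_real_derivative
            ((- f1 (U r) * ?U1 r - (real N - 1) * (U2 r / r - ?U1 r / r\<^sup>2)) * ?U1 r + U2 r * U2 r) * (\<eta> r)\<^sup>2
            + U2 r * ?U1 r * (2 * \<eta> r * \<eta>' r)) (at r)"
          by (rule derivative_eq_intros dU2 dU1 \<eta> r refl | simp)+
        from DERIV_mult[OF pw this] show ?thesis
          unfolding P_def
          by (rule DERIV_cong)
             (simp add: D_def E_def \<phi>_def \<phi>'_def deriv_f divide_inverse power2_eq_square algebra_simps)
      qed
      have "((\<lambda>r. D r - E r) has_integral P b - P a) {a..b}"
        by (rule fundamental_theorem_of_calculus[OF less_imp_le[OF ab(2)]],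
            unfold has_real_derivative_iff_has_vector_derivative[symmetric])
           (rule has_field_derivative_at_within[OF P_deriv])
      then have "integral {a..b} (\<lambda>r. D r - E r) = 0"
        using ends by (simp add: P_def integral_unique)
      then have "integral {a..b} D = integral {a..b} E"
        using integral_diff[OF integrable_continuous_real[OF D_cont] integrable_continuous_real[OF E_cont]] by simp
      then show ?thesis
        using set_lebesgue_integral_eq_integral(2)[OF set_integrable_lebesgue_continuous[OF D_cont]]
          set_lebesgue_integral_eq_integral(2)[OF set_integrable_lebesgue_continuous[OF E_cont]] by simp
    qed
    ultimately show "0 \<le> (LINT r:{a..b}|lebesgue. r ^ (N - 1) * (?U1 r)\<^sup>2 * ((\<eta>' r)\<^sup>2 - (real N - 1) / r\<^sup>2 * (\<eta> r)\<^sup>2))"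
      by (simp add: E_def)
  qed
qed

theorem proposition2p8:
  fixes N :: nat and f :: "real \<Rightarrow> real" and u :: "real ^ 'n \<Rightarrow> real" and U :: "real \<Rightarrow> real"
  assumes "N = CARD('n)" and "N \<ge> 2"
    and "f C1_differentiable_on UNIV"
    and "classical_solution f u" and "stable_solution f u"
    and "radial_profile u U"
    and "HS N U"
  shows "\<exists>u_inf :: ereal. ((\<lambda>r. ereal (U r)) \<longlongrightarrow> u_inf) at_top \<and>
    (\<exists>M>0.
      (N = 2 \<longrightarrow> (\<forall>r\<ge>2. \<bar>U r\<bar> \<le> M * ln r)) \<and>
      (N \<ge> 3 \<longrightarrow> (\<exists>c. u_inf = ereal c \<and>
        (\<forall>r\<ge>1. \<bar>U r - c\<bar> \<le> M * r powr (- real N / 2 - sqrt (real N - 1) + 2)))))"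
proof -
  let ?w = "\<lambda>r. r ^ (N - 1) * (radial_deriv U r)\<^sup>2" and ?s = "sqrt (real N - 1)"
  have s2: "?s\<^sup>2 = real N - 1"
    using assms(2) by simp
  have "weighted_stable ?w (\<lambda>r. (real N - 1) / r\<^sup>2)"
    using weighted_stable_radial_deriv[OF assms(3-6)] assms(1) by simp
  moreover have "weighted_stable_HS_axioms ?w (\<lambda>r. (real N - 1) / r\<^sup>2)"
    by unfold_locales (use assms(7) in \<open>simp add: HS_def\<close>)
  \<comment> \<open>Writing N - 1 as \<open>?s\<close> squared brings the potential into the form
    for which r^s has zero energy density.\<close>
  ultimately have "weighted_stable_HS ?w (\<lambda>r. ?s\<^sup>2 / r\<^sup>2)"
    unfolding s2 by (rule weighted_stable_HS.intro)
  moreover have "weighted_stable_HS_power_axioms ?s"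
    by unfold_locales (use assms(2) in simp)
  ultimately have stable: "weighted_stable_HS_power ?w ?s"
    by (rule weighted_stable_HS_power.intro)
  have "C2_on ext_closed u"
    using assms(4) by (simp add: classical_solution_def)
  then obtain U2 where "continuous_on {1..} U"
    "\<And>r. 1 < r \<Longrightarrow> (U has_real_derivative radial_deriv U r) (at r)"
    "\<And>r. 1 < r \<Longrightarrow> (radial_deriv U has_real_derivative U2 r) (at r)"
    "continuous_on {1<..} U2"
    by (rule radial_profile_C2[OF _ assms(6)]) blast
  then show ?thesis
    by (rule profile_asymptotics[OF stable assms(2) refl])
qed

end
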